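(* Let $0<\Delta<\pi/2$ and $0\le\theta<2\pi$, and consider the open circular billiard with the two holes $H_1=\{\beta:0<\beta<\Delta\}$ and $H_2=\{\beta:\theta<\beta<\theta+\Delta\}$. Let $\mathcal{N}_t$ be the set of orbits not escaping till time $t$. Then $$P_\infty(\theta,\Delta):=\lim_{t\to\infty}t\,\mu(\mathcal{N}_t)=\frac1{8\pi}\sum_{n=1}^{[2\pi/\Delta]}n\bigl(\phi(n)-\mu(n)\bigr)\left[g\left(\frac{2\pi}{n}-\theta'-\Delta\right)+g(\theta'-\Delta)\right],$$ where $\mu(\mathcal{N}_t)$ denotes the measure of $\mathcal{N}_t$, $\phi$ is the Euler function, $\mu(n)$ is the M\"obius function, $\theta'=\theta'(n)\in[0,\frac{2\pi}{n})$ is the residue of $\theta$ modulo $\frac{2\pi}{n}$, and $g(x)=x^2$ for $x>0$, $g(x)=0$ otherwise.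
   Context: Circular billiard: a point particle moves with unit speed in the unit disk $D$ with elastic reflections at $\partial D$. Boundary points are parametrized by the angle $\beta$ modulo $2\pi$. The phase space is $M=\{(\beta,\psi):-\pi<\beta\le\pi,\ -\frac\pi2\le\psi\le\frac\pi2\}$, where $\psi$ is the angle between the outgoing trajectory and the inner normal at $\beta$. The billiard map is $T(\beta,\psi)=(\beta+\pi-2\psi,\psi)$ (first coordinate mod $2\pi$). It preserves the probability measure $d\mu=\frac{\cos\psi}{4\pi}\,d\psi\,d\beta$ on $M$. Open billiard: the holes $H_1,H_2\subset\partial D$ (arcs, understood mod $2\pi$) may overlap. Write $T^n(\beta_0,\psi_0)=(\beta_n,\psi_0)$. Let $N(\beta_0,\psi_0)$ be the smallest integer $n\ge 0$ with $\beta_n\in H_1\cup H_2$, and $N=\infty$ if there is none. The escape time is $\tau(\beta_0,\psi_0)=2\cos\psi_0\,N(\beta_0,\psi_0)$, with $\tau=\infty$ if $N=\infty$. The set of orbits not escaping till time $t$ is $\mathcal{N}_t=\{x\in M:\tau(x)>t\}$. $[a]$ denotes the integer part of $a$. *)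

theory Defs
  imports
    "HOL-Analysis.Analysis"
    "HOL-Library.Real_Mod"
    "HOL-Library.Extended_Nat"
    "HOL-Number_Theory.Totient"
    "HOL-Computational_Algebra.Squarefree"
begin

definition phase_space :: "(real \<times> real) set" where
  "phase_space = {-pi<..pi} \<times> {-(pi/2)..pi/2}"

text \<open>The representative of an angle in the half-open interval \<open>(-\<pi>, \<pi>]\<close>.\<close>

definition norm_angle :: "real \<Rightarrow> real" where
  "norm_angle x = pi - ((pi - x) rmod (2 * pi))"

definition billiard_map :: "real \<times> real \<Rightarrow> real \<times> real" where
  "billiard_map = (\<lambda>(\<beta>, \<psi>). (norm_angle (\<beta> + pi - 2 * \<psi>), \<psi>))"

definition billiard_measure :: "(real \<times> real) measure" where
  "billiard_measure =
     density (restrict_space lborel phase_space) (\<lambda>(\<beta>, \<psi>). ennreal (cos \<psi> / (4 * pi)))"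

text \<open>The open arc of length \<open>d\<close> starting at \<open>a\<close>, as a \<open>2\<pi>\<close>-periodic set of angles.\<close>

definition arc_mod :: "real \<Rightarrow> real \<Rightarrow> real set" where
  "arc_mod a d = {\<beta>. \<exists>\<alpha>. a < \<alpha> \<and> \<alpha> < a + d \<and> [\<beta> = \<alpha>] (rmod (2 * pi))}"

text \<open>In \<^typ>\<open>enat\<close> the infimum of the empty set is \<open>\<infinity>\<close>, so orbits that never meet the
  hole set \<open>H\<close> have \<open>escape_count H x = \<infinity>\<close>.\<close>

definition escape_count :: "real set \<Rightarrow> real \<times> real \<Rightarrow> enat" where
  "escape_count H x = Inf (enat ` {n. fst ((billiard_map ^^ n) x) \<in> H})"

text \<open>The case distinction is needed because \<open>0 * \<infinity> = 0\<close> in \<^typ>\<open>ereal\<close>, whereas a tangential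
  orbit (\<open>cos \<psi> = 0\<close>) that never meets \<open>H\<close> has infinite escape time.\<close>

definition escape_time :: "real set \<Rightarrow> real \<times> real \<Rightarrow> ereal" where
  "escape_time H x =
     (case escape_count H x of
        enat n \<Rightarrow> ereal (2 * cos (snd x) * real n)
      | \<infinity> \<Rightarrow> \<infinity>)"

definition nonescaping :: "real set \<Rightarrow> real \<Rightarrow> (real \<times> real) set" where
  "nonescaping H t = {x \<in> phase_space. escape_time H x > ereal t}"

definition two_holes :: "real \<Rightarrow> real \<Rightarrow> real set" where
  "two_holes \<theta> \<Delta> = arc_mod 0 \<Delta> \<union> arc_mod \<theta> \<Delta>"

definition moebius_mu :: "nat \<Rightarrow> int" where
  "moebius_mu n = (if squarefree n then (-1) ^ card (prime_factors n) else 0)"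

definition pos_square :: "real \<Rightarrow> real" where
  "pos_square x = (if 0 < x then x\<^sup>2 else 0)"

end

theory Submission
  imports Defs
begin

text \<open>
  A trajectory with angle \<open>\<psi>\<close> visits the boundary points \<open>\<beta> + k (\<pi> - 2 \<psi>)\<close>, so it is the orbit of a
  rotation, and surviving up to time \<open>t\<close> means that the points with \<open>k \<le> t / (2 cos \<psi>)\<close> avoid the holes.
  Long survival forces the rotation to be almost periodic: by Dirichlet's theorem its angle
  is within \<open>\<Delta> / n\<close> of some \<open>2 \<pi> m / n\<close> with \<open>n\<close> at most a constant \<open>Q\<close>; every \<open>n\<close>-th point then drifts slowly in
  steps too short to jump over a hole of length \<open>\<Delta>\<close>, and it needs bounded total drift to fall into
  one. Hence a survivor lies within \<open>10 / t\<close> of one of the finitely many periodic angles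
  \<open>\<pi>/2 - \<pi> m / n\<close>; the degenerate angles \<open>\<plusminus> \<pi>/2\<close> are excluded because trajectories almost tangent to
  the circle run around it in time about \<open>2 \<pi>\<close> (lemma \<open>survivor_near_periodic\<close>).

  Near a periodic angle one magnifies: \<open>\<psi> = \<pi>/2 - \<pi> m / n + v / t\<close>. Modulo \<open>2 \<pi> / n\<close> the orbit is then an
  arithmetic progression that starts at \<open>\<beta>\<close> and, up to time \<open>t\<close>, covers more and more densely the
  segment from \<open>\<beta>\<close> to \<open>\<beta> - v / c\<close>, where \<open>c = sin (\<pi> m / n)\<close>. So in the limit, up to a null set, the orbit
  survives exactly if this segment avoids the holes folded modulo \<open>2 \<pi> / n\<close> (lemmas \<open>eventually_hit\<close> and
  \<open>eventually_survives\<close>), and dominated convergence turns \<open>t\<close> times the measure of the window into \<open>c / (4 \<pi>)\<close> times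
  the area of these pairs \<open>(\<beta>, v)\<close> (lemma \<open>window_limit\<close>). Both ends of such a segment lie in the same
  gap between folded holes, so a gap of length \<open>L\<close> contributes \<open>c L\<^sup>2\<close> to the area. Modulo \<open>2 \<pi> / n\<close> the
  gaps have lengths \<open>\<theta>' - \<Delta>\<close> and \<open>2 \<pi> / n - \<theta>' - \<Delta>\<close>, and each occurs \<open>n\<close> times on the circle.

  Summing the resulting factor \<open>c\<^sup>2 = sin\<^sup>2 (\<pi> m / n)\<close> over the \<open>m\<close> coprime to \<open>n\<close> produces
  \<open>(\<phi>(n) - \<mu>(n)) / 2\<close>, because the sum of the primitive \<open>n\<close>-th roots of unity is \<open>\<mu>(n)\<close>
  (lemma \<open>sum_sin_squared_totatives\<close>).
\<close>

section \<open>The sum of the primitive roots of unity\<close>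

lemma moebius_mu_mult_prime:
  assumes "prime p" "\<not> p dvd d"
  shows "moebius_mu (p * d) = - moebius_mu d"
proof (cases "squarefree d")
  case True
  have cop: "coprime p d" using assms by (simp add: prime_imp_coprime)
  have "squarefree (p * d)" 
    using squarefree_mult_coprime[OF cop squarefree_prime] True assms by simp
  moreover have "d \<noteq> 0" using assms by (metis dvd_0_right)
  hence "prime_factors (p * d) = insert p (prime_factors d)"
    using assms by (subst prime_factors_product) (auto simp: prime_prime_factors)
  moreover have "p \<notin> prime_factors d" using assms by auto
  ultimately show ?thesis using True by (simp add: moebius_mu_def)
next
  case False
  hence "\<not> squarefree (p * d)" by (metis squarefree_mono dvd_triv_right)
  thus ?thesis using False by (simp add: moebius_mu_def)
qed

text \<open>
  Multiplication by a prime factor \<open>p\<close> of \<open>n\<close> pairs the squarefree divisors prime to \<open>p\<close> with those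
  divisible by \<open>p\<close>, and it flips the sign of \<open>\<mu>\<close>.
\<close>

lemma sum_moebius_mu_divisors:
  assumes "n > 1"
  shows "(\<Sum>d | d dvd n. moebius_mu d) = 0"
proof -
  obtain p where p: "prime p" "p dvd n" using assms by (metis less_irrefl prime_factor_nat)
  have p0: "p \<noteq> 0" using p by auto
  define D where "D = {d. d dvd n \<and> squarefree d \<and> \<not> p dvd d}"
  have fin: "finite {d. d dvd n}" using assms by simp
  hence finD: "finite D" by (rule rev_finite_subset) (auto simp: D_def)
  have split: "{d. d dvd n \<and> squarefree d} = D \<union> (\<lambda>d. p * d) ` D"
  proof (intro equalityI subsetI)
    fix d assume d: "d \<in> {d. d dvd n \<and> squarefree d}"
    show "d \<in> D \<union> (\<lambda>d. p * d) ` D"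
    proof (cases "p dvd d")
      case True
      then obtain e where e: "d = p * e" by auto
      have "\<not> p dvd e"
      proof
        assume "p dvd e"
        hence "p\<^sup>2 dvd d" using e by (simp add: power2_eq_square)
        hence "p dvd 1" using d by (auto simp: squarefree_def)
        thus False using p by auto
      qed
      moreover have "squarefree e" using d e squarefree_mono[of e d] by simp
      moreover have "e dvd n" using d e by (auto intro: dvd_trans[of e d n])
      ultimately show ?thesis using e by (auto simp: D_def)
    qed (use d in \<open>auto simp: D_def\<close>)
  next
    fix d assume "d \<in> D \<union> (\<lambda>d. p * d) ` D"
    then consider "d \<in> D" | e where "e \<in> D" "d = p * e" by auto
    thus "d \<in> {d. d dvd n \<and> squarefree d}"
    proof cases
      case 2
      have "coprime p e" using 2 p by (simp add: prime_imp_coprime D_def)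
      thus ?thesis using 2 p
        by (auto simp: D_def intro: divides_mult squarefree_mult_coprime squarefree_prime)
    qed (auto simp: D_def)
  qed
  have "(\<Sum>d | d dvd n. moebius_mu d) = (\<Sum>d | d dvd n \<and> squarefree d. moebius_mu d)"
    using fin by (intro sum.mono_neutral_right) (auto simp: moebius_mu_def)
  also have "\<dots> = (\<Sum>d\<in>D. moebius_mu d) + (\<Sum>d\<in>(\<lambda>d. p * d) ` D. moebius_mu d)"
    unfolding split using finD by (intro sum.union_disjoint) (auto simp: D_def)
  also have "(\<Sum>d\<in>(\<lambda>d. p * d) ` D. moebius_mu d) = (\<Sum>d\<in>D. moebius_mu (p * d))"
    by (rule sum.reindex_cong[where l = "\<lambda>d. p * d"]) (use p0 in \<open>auto simp: inj_on_def\<close>)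
  also have "\<dots> = (\<Sum>d\<in>D. - moebius_mu d)"
    by (intro sum.cong refl moebius_mu_mult_prime p) (auto simp: D_def)
  finally show ?thesis by (simp add: sum_negf)
qed

lemma sum_cos_residues:
  assumes "n > 1"
  shows "(\<Sum>k\<in>{0<..n}. cos (2 * pi * real k / real n)) = 0"
proof -
  have "(\<Sum>k<n. cis (2 * pi * real k / real n)) = \<Sum>{z::complex. z ^ n = 1}"
    using assms sum.reindex_bij_betw[OF Complex.bij_betw_roots_unity[of n], of "\<lambda>z. z"] by simp
  also have "\<dots> = 0" by (rule sum_roots_unity[OF assms])
  finally have "Re (\<Sum>k<n. cis (2 * pi * real k / real n)) = 0" by simp
  hence *: "(\<Sum>k<n. cos (2 * pi * real k / real n)) = 0" by simp
  have "{0<..n} = insert n {0<..<n}" "{..<n} = insert 0 {0<..<n}" using assms by auto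
  thus ?thesis using * assms by simp
qed

text \<open>
  Both sides have the same divisor sums, namely \<open>1\<close> for \<open>n = 1\<close> and \<open>0\<close> otherwise: on the left, grouping
  all residues modulo \<open>n\<close> by their gcd with \<open>n\<close> gives the sum of all \<open>n\<close>-th roots of unity. Induction on \<open>n\<close>
  then isolates the term of \<open>n\<close> itself.
\<close>

lemma sum_cos_totatives:
  assumes "n > 0"
  shows "(\<Sum>k\<in>totatives n. cos (2 * pi * real k / real n)) = real_of_int (moebius_mu n)"
  using assms
proof (induction n rule: less_induct)
  case (less n)
  define c where "c m = (\<Sum>k\<in>totatives m. cos (2 * pi * real k / real m))" for m
  show ?case
  proof (cases "n = 1")
    case True
    thus ?thesis by (simp add: moebius_mu_def)
  next
    case False
    hence n: "n > 1" using less by auto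
    have "0 = (\<Sum>k\<in>{0<..n}. cos (2 * pi * real k / real n))"
      using sum_cos_residues[OF n] by simp
    also have "\<dots> = (\<Sum>d | d dvd n. \<Sum>k | k \<in> {0<..n} \<and> gcd k n = d. cos (2 * pi * real k / real n))"
      using n by (intro sum.group[symmetric]) auto
    also have "\<dots> = (\<Sum>d | d dvd n. c (n div d))"
    proof (intro sum.cong refl)
      fix d assume d: "d \<in> {d. d dvd n}"
      hence d0: "d > 0" using n by (auto intro: Nat.gr0I)
      have "(\<Sum>k | k \<in> {0<..n} \<and> gcd k n = d. cos (2 * pi * real k / real n)) =
        (\<Sum>k\<in>totatives (n div d). cos (2 * pi * real (k * d) / real n))"
        using d n by (intro sum.reindex_bij_betw[OF bij_betw_totatives_gcd_eq, symmetric]) auto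
      also have "\<dots> = c (n div d)"
        unfolding c_def using d d0 by (intro sum.cong refl) (auto simp: real_of_nat_div field_simps)
      finally show "(\<Sum>k | k \<in> {0<..n} \<and> gcd k n = d. cos (2 * pi * real k / real n)) = c (n div d)" .
    qed
    also have "\<dots> = (\<Sum>d | d dvd n. c d)"
      by (rule sum.reindex_bij_witness[of _ "(div) n" "(div) n"]) (use n in \<open>auto elim!: dvdE\<close>)
    also have "\<dots> = c n + (\<Sum>d | d dvd n \<and> d \<noteq> n. c d)"
      using n by (subst sum.remove[of _ n]) (auto intro!: sum.cong)
    also have "(\<Sum>d | d dvd n \<and> d \<noteq> n. c d) = (\<Sum>d | d dvd n \<and> d \<noteq> n. real_of_int (moebius_mu d))"
      unfolding c_def using n by (intro sum.cong refl less.IH) (auto intro: Nat.gr0I le_neq_implies_less dvd_imp_le)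
    also have "\<dots> = real_of_int (\<Sum>d | d dvd n. moebius_mu d) - real_of_int (moebius_mu n)"
      using n by (subst (2) sum.remove[of _ n]) (auto intro!: sum.cong)
    finally show ?thesis using sum_moebius_mu_divisors[OF n] by (simp add: c_def)
  qed
qed

text \<open>
  By \<open>sin\<^sup>2 x = (1 - cos (2 x)) / 2\<close>, this splits into a count and the previous sum.
\<close>

lemma sum_sin_squared_totatives:
  assumes "n > 0"
  shows "(\<Sum>m\<in>totatives n. (sin (pi * real m / real n))\<^sup>2) =
    (real (totient n) - real_of_int (moebius_mu n)) / 2"
proof -
  have "(sin (pi * real m / real n))\<^sup>2 = (1 - cos (2 * pi * real m / real n)) / 2" for m
    using cos_double_sin[of "pi * real m / real n"] by (simp add: field_simps)
  hence "(\<Sum>m\<in>totatives n. (sin (pi * real m / real n))\<^sup>2) =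
      (\<Sum>m\<in>totatives n. (1 - cos (2 * pi * real m / real n)) / 2)"
    by (intro sum.cong refl) simp
  also have "\<dots> = (\<Sum>m\<in>totatives n. 1 - cos (2 * pi * real m / real n)) / 2"
    by (rule sum_divide_distrib[symmetric])
  also have "\<dots> = (real (totient n) - real_of_int (moebius_mu n)) / 2"
    by (simp add: sum_subtractf totient_def sum_cos_totatives[OF assms])
  finally show ?thesis .
qed

section \<open>Survival as a property of the rotation orbit\<close>

lemma mem_arc_mod_iff:
  "x \<in> arc_mod a d \<longleftrightarrow> (\<exists>j::int. a < x + of_int j * (2 * pi) \<and> x + of_int j * (2 * pi) < a + d)"
  by (auto simp: arc_mod_def rcong_altdef)

lemma arc_mod_shift [simp]: "x + of_int j * (2 * pi) \<in> arc_mod a d \<longleftrightarrow> x \<in> arc_mod a d"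
proof -
  have *: "y + of_int i * (2 * pi) \<in> arc_mod a d" if "y \<in> arc_mod a d" for y and i :: int
  proof -
    from that obtain k :: int where "a < y + of_int k * (2 * pi)" "y + of_int k * (2 * pi) < a + d"
      by (auto simp: mem_arc_mod_iff)
    thus ?thesis unfolding mem_arc_mod_iff by (intro exI[of _ "k - i"]) (simp add: algebra_simps)
  qed
  from *[of x j] *[of "x + of_int j * (2 * pi)" "-j"] show ?thesis by auto
qed

lemma open_arc_mod: "open (arc_mod a d)"
proof -
  have "arc_mod a d = (\<Union>j::int. {a - of_int j * (2 * pi) <..< a + d - of_int j * (2 * pi)})"
    by (auto simp: mem_arc_mod_iff algebra_simps)
  thus ?thesis by auto
qed

lemma two_holes_shift [simp]:
  "x + of_int j * (2 * pi) \<in> two_holes \<theta> \<Delta> \<longleftrightarrow> x \<in> two_holes \<theta> \<Delta>"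
  by (simp add: two_holes_def)

lemma open_two_holes: "open (two_holes \<theta> \<Delta>)"
  by (simp add: two_holes_def open_arc_mod open_Un)

lemma norm_angle_eq_shift: "\<exists>j::int. norm_angle x = x + of_int j * (2 * pi)"
  by (rule exI[of _ "\<lfloor>(pi - x) / (2 * pi)\<rfloor>"]) (simp add: norm_angle_def rmod_def)

lemma billiard_map_iterate:
  "\<exists>j::int. (billiard_map ^^ k) (\<beta>, \<psi>) = (\<beta> + real k * (pi - 2 * \<psi>) + of_int j * (2 * pi), \<psi>)"
proof (induction k)
  case 0
  show ?case by (rule exI[of _ 0]) simp
next
  case (Suc k)
  then obtain j :: int where
    j: "(billiard_map ^^ k) (\<beta>, \<psi>) = (\<beta> + real k * (pi - 2 * \<psi>) + of_int j * (2 * pi), \<psi>)" by auto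
  obtain i :: int where
    "norm_angle (\<beta> + real k * (pi - 2 * \<psi>) + of_int j * (2 * pi) + pi - 2 * \<psi>) =
     \<beta> + real k * (pi - 2 * \<psi>) + of_int j * (2 * pi) + pi - 2 * \<psi> + of_int i * (2 * pi)"
    using norm_angle_eq_shift by blast
  thus ?case using j
    by (intro exI[of _ "i + j"]) (simp add: billiard_map_def algebra_simps)
qed

text \<open>
  The reflections up to time \<open>t\<close> are those with \<open>2 cos \<psi> * k \<le> t\<close>. Leaving the angles unreduced turns
  the orbit into an arithmetic progression on the real line.
\<close>

definition survives :: "real set \<Rightarrow> real \<Rightarrow> real \<Rightarrow> real \<Rightarrow> bool" where
  "survives H t \<beta> \<psi> \<longleftrightarrow>
     (\<forall>k::nat. 2 * cos \<psi> * real k \<le> t \<longrightarrow> \<beta> + real k * (pi - 2 * \<psi>) \<notin> H)"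

text \<open>
  Flight times are nonnegative, so the first visit to \<open>H\<close> is also the one with the least time, and
  it suffices to compare the time of every visit with \<open>t\<close>. An orbit without visits satisfies both sides.
\<close>

lemma nonescaping_iff_survives:
  assumes per: "\<And>x (j::int). x + of_int j * (2 * pi) \<in> H \<longleftrightarrow> x \<in> H"
    and ps: "(\<beta>, \<psi>) \<in> phase_space"
  shows "(\<beta>, \<psi>) \<in> nonescaping H t \<longleftrightarrow> survives H t \<beta> \<psi>"
proof -
  have cos: "cos \<psi> \<ge> 0" using ps by (auto simp: phase_space_def intro!: cos_ge_zero)
  define A where "A = {k. \<beta> + real k * (pi - 2 * \<psi>) \<in> H}"
  have "fst ((billiard_map ^^ k) (\<beta>, \<psi>)) \<in> H \<longleftrightarrow> \<beta> + real k * (pi - 2 * \<psi>) \<in> H" for k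
    using billiard_map_iterate[of k \<beta> \<psi>] per by auto
  hence cnt: "escape_count H (\<beta>, \<psi>) = Inf (enat ` A)"
    by (simp add: escape_count_def A_def)
  have "escape_time H (\<beta>, \<psi>) > ereal t \<longleftrightarrow> (\<forall>k\<in>A. 2 * cos \<psi> * real k > t)"
  proof (cases "A = {}")
    case True
    thus ?thesis using cnt by (simp add: escape_time_def Inf_enat_def)
  next
    case False
    define l where "l = (LEAST k. k \<in> A)"
    have l: "l \<in> A" unfolding l_def using False by (auto intro: LeastI)
    have le: "l \<le> k" if "k \<in> A" for k using that unfolding l_def by (rule Least_le)
    have "Inf (enat ` A) = enat l"
      using l le by (intro antisym Inf_lower Inf_greatest) auto
    hence "escape_time H (\<beta>, \<psi>) = ereal (2 * cos \<psi> * real l)"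
      using cnt by (simp add: escape_time_def)
    moreover have "2 * cos \<psi> * real l \<le> 2 * cos \<psi> * real k" if "k \<in> A" for k
      using le[OF that] cos by (intro mult_left_mono) auto
    ultimately show ?thesis using l by (auto intro: less_le_trans)
  qed
  thus ?thesis using ps by (auto simp: nonescaping_def survives_def A_def not_le)
qed


section \<open>Long-lived orbits are almost periodic\<close>

text \<open>
  A progression with steps shorter than \<open>\<Delta>\<close> cannot jump over an arc of length \<open>\<Delta>\<close>. A negative drift
  reduces to a positive one by the reflection \<open>x \<mapsto> \<Delta> - x\<close>, which preserves the arc.
\<close>

lemma drift_enters_arc:
  assumes "\<eta> \<noteq> 0" "\<bar>\<eta>\<bar> < \<Delta>"
  shows "\<exists>i::nat. real i * \<bar>\<eta>\<bar> \<le> 2 * pi + \<Delta> \<and> \<beta> + real i * \<eta> \<in> arc_mod 0 \<Delta>"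
proof -
  have pos: "\<exists>i::nat. real i * e \<le> 2 * pi + \<Delta> \<and> x + real i * e \<in> arc_mod 0 \<Delta>"
    if e: "0 < e" "e < \<Delta>" for x e
  proof -
    define j where "j = \<lfloor>-x / (2 * pi)\<rfloor>"
    \<comment> \<open>The lift of \<open>x\<close> in \<open>(-2\<pi>, 0]\<close>; the arc begins at \<open>0\<close>.\<close>
    define y where "y = x + of_int j * (2 * pi)"
    have "of_int j \<le> -x / (2 * pi)" "-x / (2 * pi) < of_int j + 1" by (simp_all add: j_def)
    hence y: "y \<le> 0" "-(2 * pi) < y" by (auto simp: y_def field_simps)
    define i where "i = nat \<lfloor>-y / e\<rfloor> + 1"
    have "-y / e \<ge> 0" using y e by (intro divide_nonneg_pos) auto
    hence "real i = of_int \<lfloor>-y / e\<rfloor> + 1" by (simp add: i_def)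
    hence "real i \<le> -y / e + 1" "-y / e < real i" by linarith+
    hence i: "real i * e \<le> -y + e" "-y < real i * e" using e by (auto simp: field_simps)
    have "0 < x + real i * e + of_int j * (2 * pi)" "x + real i * e + of_int j * (2 * pi) < 0 + \<Delta>"
      using i e by (auto simp: y_def)
    hence "x + real i * e \<in> arc_mod 0 \<Delta>" unfolding mem_arc_mod_iff by blast
    moreover have "real i * e \<le> 2 * pi + \<Delta>" using i e y by linarith
    ultimately show ?thesis by blast
  qed
  show ?thesis
  proof (cases "\<eta> > 0")
    case True
    thus ?thesis using pos[of \<eta> \<beta>] assms by simp
  next
    case False
    then obtain i :: nat where
      i: "real i * -\<eta> \<le> 2 * pi + \<Delta>" "(\<Delta> - \<beta>) + real i * -\<eta> \<in> arc_mod 0 \<Delta>"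
      using pos[of "-\<eta>" "\<Delta> - \<beta>"] assms by auto
    then obtain j :: int where
      "0 < (\<Delta> - \<beta>) + real i * -\<eta> + of_int j * (2 * pi)"
      "(\<Delta> - \<beta>) + real i * -\<eta> + of_int j * (2 * pi) < 0 + \<Delta>"
      unfolding mem_arc_mod_iff by blast
    hence "\<beta> + real i * \<eta> \<in> arc_mod 0 \<Delta>" unfolding mem_arc_mod_iff
      by (intro exI[of _ "-j"]) (auto simp: algebra_simps)
    thus ?thesis using i(1) False assms by (intro exI[of _ i]) auto
  qed
qed

text \<open>
  If \<open>\<eta> \<noteq> 0\<close> is the drift after \<open>k\<close> reflections, then the orbit escapes after at most \<open>8 / \<bar>\<eta>\<bar>\<close> such
  rounds, that is, by time \<open>16 k cos \<psi> / \<bar>\<eta>\<bar>\<close>; survival until \<open>t\<close> bounds \<open>\<bar>\<eta>\<bar>\<close> by a multiple of \<open>1 / t\<close>. For the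
  fractions \<open>0\<close> and \<open>1\<close> the drift is itself proportional to the angle \<open>a\<close> to the tangent and
  \<open>cos \<psi> \<le> a\<close>, so the escape time is at most \<open>8\<close>.
  Both constants \<open>8\<close> are rounded up to \<open>10\<close>.
\<close>

lemma survivor_near_periodic:
  fixes Q :: nat
  assumes Q: "Q > 0" "2 * pi / real Q \<le> \<Delta>" and \<Delta>: "\<Delta> < pi / 2"
    and \<psi>: "-(pi / 2) < \<psi>" "\<psi> < pi / 2" and t: "t \<ge> 10"
    and H: "arc_mod 0 \<Delta> \<subseteq> H" and surv: "survives H t \<beta> \<psi>"
  shows "\<exists>n\<in>{2..Q}. \<exists>m\<in>totatives n. \<bar>\<psi> - (pi / 2 - pi * real m / real n)\<bar> \<le> 10 / t"
proof -
  have cos: "cos \<psi> > 0" using \<psi> by (intro cos_gt_zero_pi) auto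
  define x where "x = (pi - 2 * \<psi>) / (2 * pi)"
  have x: "0 < x" "x < 1" using \<psi> by (auto simp: x_def field_simps)
  obtain h k :: int where hk: "coprime h k" "0 < k" "k \<le> int Q" "\<bar>of_int k * x - of_int h\<bar> < 1 / Q"
    using Dirichlet_approx_coprime[OF Q(1)] by metis
  define \<eta> where "\<eta> = real_of_int k * (pi - 2 * \<psi>) - 2 * pi * of_int h"
  have "\<eta> = 2 * pi * (of_int k * x - of_int h)" by (simp add: \<eta>_def x_def field_simps)
  hence "\<bar>\<eta>\<bar> = 2 * pi * \<bar>of_int k * x - of_int h\<bar>" by (simp add: abs_mult)
  also have "\<dots> < 2 * pi * (1 / Q)" using hk(4) by (intro mult_strict_left_mono) auto
  finally have \<eta>: "\<bar>\<eta>\<bar> < \<Delta>" using Q(2) by simp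
  \<comment> \<open>The constant is twice \<open>8\<close>, a bound for \<open>2 \<pi> + \<Delta>\<close>.\<close>
  have key: "t * \<bar>\<eta>\<bar> < 16 * real_of_int k * cos \<psi>" if "\<eta> \<noteq> 0"
  proof -
    obtain i :: nat where i: "real i * \<bar>\<eta>\<bar> \<le> 2 * pi + \<Delta>" "\<beta> + real i * \<eta> \<in> arc_mod 0 \<Delta>"
      using drift_enters_arc[OF \<open>\<eta> \<noteq> 0\<close> \<eta>] by blast
    have "\<beta> + real (i * nat k) * (pi - 2 * \<psi>) = \<beta> + real i * \<eta> + of_int (int i * h) * (2 * pi)"
      using hk(2) by (simp add: \<eta>_def algebra_simps)
    hence "\<beta> + real (i * nat k) * (pi - 2 * \<psi>) \<in> arc_mod 0 \<Delta>"
      using i(2) arc_mod_shift[of "\<beta> + real i * \<eta>" "int i * h" 0 \<Delta>] by (simp only:)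
    hence "t < 2 * cos \<psi> * real (i * nat k)"
      using surv H unfolding survives_def by (meson not_le subsetD)
    hence "t * \<bar>\<eta>\<bar> < 2 * cos \<psi> * real (i * nat k) * \<bar>\<eta>\<bar>"
      using \<open>\<eta> \<noteq> 0\<close> by (intro mult_strict_right_mono) auto
    also have "\<dots> = 2 * cos \<psi> * of_int k * (real i * \<bar>\<eta>\<bar>)" using hk(2) by simp
    also have "\<dots> \<le> 2 * cos \<psi> * of_int k * 8"
    proof (rule mult_left_mono)
      have "pi \<le> 31415926535899 / 10 ^ 13" by (rule pi_approx)
      also have "\<dots> \<le> 16 / 5" by simp
      finally have "2 * pi + \<Delta> \<le> 8" using \<Delta> by simp
      thus "real i * \<bar>\<eta>\<bar> \<le> 8" using i(1) by linarith
    qed (use cos hk(2) in auto)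
    finally show ?thesis by (simp add: mult_ac)
  qed
  \<comment> \<open>Here \<open>a\<close> is the angle to the tangent, \<open>\<pi>/2 - \<psi>\<close> or \<open>\<pi>/2 + \<psi>\<close>.\<close>
  have tang: False if a: "0 < a" "cos \<psi> \<le> a" "\<bar>\<eta>\<bar> = 2 * of_int k * a" for a
  proof -
    have "\<eta> \<noteq> 0" using a hk(2) by auto
    hence "t * (2 * of_int k * a) < 16 * real_of_int k * cos \<psi>" using key a(3) by simp
    also have "\<dots> \<le> 16 * real_of_int k * a" using a hk(2) by (intro mult_left_mono) auto
    finally have "(2 * of_int k * a) * t < (2 * of_int k * a) * 8" by (simp add: mult_ac)
    hence "t < 8" using a hk(2) by (subst (asm) mult_less_cancel_left_pos) auto
    thus False using t by simp
  qed
  have "1 / real Q \<le> 1" using Q by simp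
  hence "\<bar>of_int k * x - of_int h\<bar> < 1" using hk(4) by linarith
  moreover have "0 < of_int k * x" "of_int k * x < of_int k" using x hk(2) by auto
  ultimately have "real_of_int h > -1" "real_of_int h < of_int k + 1" by linarith+
  hence h: "0 \<le> h" "h \<le> k" by linarith+
  have "h \<noteq> 0"
  proof
    assume "h = 0"
    have "cos \<psi> = sin (pi / 2 - \<psi>)" by (simp add: sin_diff)
    also have "\<dots> \<le> pi / 2 - \<psi>" using \<psi> by (intro sin_x_le_x) auto
    finally show False
      using tang[of "pi / 2 - \<psi>"] \<psi> hk(2) \<open>h = 0\<close> by (auto simp: \<eta>_def abs_mult)
  qed
  moreover have "h \<noteq> k"
  proof
    assume "h = k"
    have "cos \<psi> = sin (pi / 2 + \<psi>)" by (simp add: sin_add)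
    also have "\<dots> \<le> pi / 2 + \<psi>" using \<psi> by (intro sin_x_le_x) auto
    finally have c: "cos \<psi> \<le> pi / 2 + \<psi>" .
    have "\<eta> = - (2 * of_int k * (pi / 2 + \<psi>))" using \<open>h = k\<close> by (simp add: \<eta>_def algebra_simps)
    hence "\<bar>\<eta>\<bar> = 2 * of_int k * (pi / 2 + \<psi>)" using \<psi> hk(2) by (simp add: abs_mult)
    thus False using tang[of "pi / 2 + \<psi>"] \<psi> c by auto
  qed
  ultimately have h: "0 < h" "h < k" using h by auto
  have "t * \<bar>\<eta>\<bar> \<le> 16 * real_of_int k * cos \<psi>" using key cos hk(2) by (cases "\<eta> = 0") auto
  also have "\<dots> \<le> 16 * real_of_int k * 1" using hk(2) by (intro mult_left_mono) auto
  finally have "\<bar>\<eta>\<bar> / (2 * of_int k) \<le> 8 / t" using hk(2) t by (simp add: field_simps)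
  also have "\<dots> \<le> 10 / t" using t by (intro divide_right_mono) auto
  also have "\<bar>\<eta>\<bar> / (2 * of_int k) = \<bar>\<psi> - (pi / 2 - pi * of_int h / of_int k)\<bar>"
  proof -
    have "\<psi> - (pi / 2 - pi * of_int h / of_int k) = - (\<eta> / (2 * of_int k))"
      using hk(2) by (simp add: \<eta>_def field_simps)
    thus ?thesis using hk(2) by (simp add: abs_divide)
  qed
  finally have fin: "\<bar>\<psi> - (pi / 2 - pi * of_int h / of_int k)\<bar> \<le> 10 / t" .
  obtain m n :: nat where mn: "h = int m" "k = int n" using h hk(2) by (metis nonneg_int_cases less_imp_le)
  have "m \<in> totatives n" "n \<in> {2..Q}" using h hk(1,3) mn by (auto simp: in_totatives_iff)
  thus ?thesis using fin mn by (intro bexI[of _ n] bexI[of _ m]) auto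
qed

section \<open>Orbits close to a periodic one\<close>

text \<open>
  The projection of \<open>H\<close> to the circle of length \<open>2 \<pi> / n\<close>, lifted to the real line: an orbit that is
  nearly \<open>n\<close>-periodic visits all translates of a point by multiples of \<open>2 \<pi> / n\<close>.
\<close>

definition fold_set :: "nat \<Rightarrow> real set \<Rightarrow> real set" where
  "fold_set n H = {x. \<exists>j::int. x + of_int j * (2 * pi / real n) \<in> H}"

lemma open_fold_set: "open H \<Longrightarrow> open (fold_set n H)"
proof -
  assume H: "open H"
  have "fold_set n H = (\<Union>j::int. (\<lambda>x. x + of_int j * (2 * pi / real n)) -` H)"
    by (auto simp: fold_set_def)
  also have "open \<dots>" using H by (intro open_UN ballI open_vimage continuous_intros)
  finally show ?thesis .
qed

lemma fold_set_shift [simp]: "x + 2 * pi / real n \<in> fold_set n H \<longleftrightarrow> x \<in> fold_set n H"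
proof
  assume "x + 2 * pi / real n \<in> fold_set n H"
  then obtain j :: int where "x + 2 * pi / real n + of_int j * (2 * pi / real n) \<in> H"
    by (auto simp: fold_set_def)
  moreover have "x + 2 * pi / real n + of_int j * (2 * pi / real n) = x + of_int (j + 1) * (2 * pi / real n)"
    by (simp add: algebra_simps add_divide_distrib)
  ultimately show "x \<in> fold_set n H" unfolding fold_set_def by (metis (mono_tags) mem_Collect_eq)
next
  assume "x \<in> fold_set n H"
  then obtain j :: int where "x + of_int j * (2 * pi / real n) \<in> H"
    by (auto simp: fold_set_def)
  moreover have "x + of_int j * (2 * pi / real n) = x + 2 * pi / real n + of_int (j - 1) * (2 * pi / real n)"
    by (simp add: algebra_simps diff_divide_distrib add_divide_distrib)
  ultimately show "x + 2 * pi / real n \<in> fold_set n H"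
    unfolding fold_set_def by (metis (mono_tags) mem_Collect_eq)
qed

text \<open>
  Some of \<open>n\<close> consecutive reflections visits the translate that lies in the given hole.
\<close>

lemma exists_residue_in_window:
  fixes m n :: nat and j :: int
  assumes "n > 0" "coprime m n" "x \<ge> 0"
  shows "\<exists>k::nat. x \<le> real k \<and> real k \<le> x + real n \<and> [int k * int m = j] (mod int n)"
proof -
  have "coprime (int m) (int n)" using assms by simp
  then obtain i where i: "[int m * i = 1] (mod int n)" by (metis cong_solve_coprime_int)
  define r where "r = nat ((i * j - \<lceil>x\<rceil>) mod int n)"
  have r: "int r = (i * j - \<lceil>x\<rceil>) mod int n" "r < n" using assms by (auto simp: r_def nat_less_iff)
  define k where "k = nat \<lceil>x\<rceil> + r"
  have x: "\<lceil>x\<rceil> \<ge> 0" using assms by simp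
  have k: "int k = \<lceil>x\<rceil> + int r" using x by (simp add: k_def)
  have "[int k = \<lceil>x\<rceil> + (i * j - \<lceil>x\<rceil>)] (mod int n)"
    unfolding k r by (simp add: cong_def mod_simps)
  hence "[int k * int m = i * j * int m] (mod int n)" by (simp add: cong_mult)
  also have "i * j * int m = (int m * i) * j" by (simp add: mult_ac)
  also have "[(int m * i) * j = 1 * j] (mod int n)" by (intro cong_mult i cong_refl)
  finally have "[int k * int m = j] (mod int n)" by simp
  moreover have "real k = of_int \<lceil>x\<rceil> + real r" using k by (metis of_int_add of_int_of_nat_eq)
  moreover have "x \<le> of_int \<lceil>x\<rceil>" "of_int \<lceil>x\<rceil> < x + 1" by linarith+
  moreover have "real r + 1 \<le> real n" using r(2) by linarith
  ultimately show ?thesis by (intro exI[of _ k] conjI) linarith+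
qed

text \<open>
  If the limit segment meets the folded holes, it does so at a parameter \<open>s\<close> below \<open>1\<close>, since they are
  open. Up to time \<open>t\<close> there are about \<open>t / (2 c)\<close> reflections; a number \<open>k\<close> of reflections within \<open>n\<close> of
  \<open>s t / (2 c)\<close> and of suitable residue modulo \<open>n\<close> takes the orbit as close as desired to a point of \<open>H\<close>.
\<close>

lemma eventually_hit:
  fixes m n :: nat and H :: "real set" and v \<beta> s :: real
  defines "c \<equiv> sin (pi * real m / real n)"
  assumes H: "open H" and per: "\<And>x (j::int). x + of_int j * (2 * pi) \<in> H \<longleftrightarrow> x \<in> H"
    and n: "n > 0" "coprime m n" and c: "c > 0"
    and s: "0 \<le> s" "s \<le> 1" "\<beta> - s * (v / c) \<in> fold_set n H"
  shows "\<forall>\<^sub>F t in at_top. \<not> survives H t \<beta> (pi / 2 - pi * real m / real n + v / t)"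
proof -
  let ?U = "\<lambda>s. \<beta> - s * (v / c)"
  obtain s' where s': "0 \<le> s'" "s' < 1" "?U s' \<in> fold_set n H"
  proof (cases "s < 1")
    case True
    thus ?thesis using that s by auto
  next
    case False
    hence "open (?U -` fold_set n H)" "1 \<in> ?U -` fold_set n H"
      using s c open_fold_set[OF H] by (auto intro!: open_vimage continuous_intros)
    then obtain e where e: "e > 0" "ball 1 e \<subseteq> ?U -` fold_set n H"
      by (metis open_contains_ball)
    define s' where "s' = max 0 (1 - e / 2)"
    have "s' \<in> ball 1 e" using e by (auto simp: s'_def dist_real_def)
    thus ?thesis using e that[of s'] by (auto simp: s'_def)
  qed
  obtain j :: int where j: "?U s' + of_int j * (2 * pi / real n) \<in> H"
    using s'(3) by (auto simp: fold_set_def)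
  have "\<exists>k::nat. s' * \<bar>t\<bar> / (2 * c) \<le> real k \<and> real k \<le> s' * \<bar>t\<bar> / (2 * c) + real n
      \<and> [int k * int m = j] (mod int n)" for t
    using c s' n by (intro exists_residue_in_window) auto
  then obtain k :: "real \<Rightarrow> nat" where k:
    "\<And>t. s' * \<bar>t\<bar> / (2 * c) \<le> real (k t)" "\<And>t. real (k t) \<le> s' * \<bar>t\<bar> / (2 * c) + real n"
    "\<And>t. [int (k t) * int m = j] (mod int n)" by metis
  have kt: "((\<lambda>t. real (k t) / t) \<longlongrightarrow> s' / (2 * c)) at_top"
  proof (rule tendsto_sandwich)
    show "\<forall>\<^sub>F t in at_top. s' / (2 * c) \<le> real (k t) / t"
      using eventually_gt_at_top[of 0]
    proof eventually_elim
      case (elim t)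
      thus ?case using k(1)[of t] c by (simp add: field_simps)
    qed
    show "\<forall>\<^sub>F t in at_top. real (k t) / t \<le> s' / (2 * c) + real n / t"
      using eventually_gt_at_top[of 0]
    proof eventually_elim
      case (elim t)
      thus ?case using k(2)[of t] c by (simp add: field_simps)
    qed
    have "((\<lambda>t. s' / (2 * c) + real n / t) \<longlongrightarrow> s' / (2 * c) + 0) at_top"
      by (intro tendsto_intros tendsto_divide_0[OF tendsto_const] filterlim_at_top_imp_at_infinity filterlim_ident)
    thus "((\<lambda>t. s' / (2 * c) + real n / t) \<longlongrightarrow> s' / (2 * c)) at_top" by simp
  qed auto
  have vt: "((\<lambda>t. v / t) \<longlongrightarrow> 0) at_top"
    by (intro tendsto_divide_0[OF tendsto_const] filterlim_at_top_imp_at_infinity filterlim_ident)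
  have "((\<lambda>t. \<beta> - 2 * v * (real (k t) / t) + of_int j * (2 * pi / real n)) \<longlongrightarrow>
      \<beta> - 2 * v * (s' / (2 * c)) + of_int j * (2 * pi / real n)) at_top"
    by (intro tendsto_intros kt)
  moreover have "\<beta> - 2 * v * (s' / (2 * c)) + of_int j * (2 * pi / real n) \<in> H"
    using j by (simp add: mult_ac)
  ultimately have ev1: "\<forall>\<^sub>F t in at_top. \<beta> - 2 * v * (real (k t) / t) + of_int j * (2 * pi / real n) \<in> H"
    by (rule topological_tendstoD[OF _ H])
  have "((\<lambda>t. 2 * sin (pi * real m / real n - v / t) * (real (k t) / t)) \<longlongrightarrow>
      2 * sin (pi * real m / real n - 0) * (s' / (2 * c))) at_top"
    by (intro tendsto_intros kt vt)
  moreover have "2 * sin (pi * real m / real n - 0) * (s' / (2 * c)) < 1"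
    using c s' by (simp add: c_def)
  ultimately have ev2: "\<forall>\<^sub>F t in at_top. 2 * sin (pi * real m / real n - v / t) * (real (k t) / t) < 1"
    by (rule order_tendstoD(2))
  show ?thesis using ev1 ev2 eventually_gt_at_top[of 0]
  proof eventually_elim
    case (elim t)
    let ?\<psi> = "pi / 2 - pi * real m / real n + v / t"
    have "cos ?\<psi> = cos (pi / 2 - (pi * real m / real n - v / t))" by (simp add: algebra_simps)
    also have "\<dots> = sin (pi * real m / real n - v / t)" by (simp add: cos_diff)
    finally have "2 * cos ?\<psi> * real (k t) \<le> t" using elim(2,3) by (simp add: field_simps)
    moreover have "\<beta> + real (k t) * (pi - 2 * ?\<psi>) \<in> H"
    proof -
      obtain q where q: "int (k t) * int m = j + int n * q"
        using k(3)[of t] by (metis cong_iff_lin cong_sym)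
      have "\<beta> + real (k t) * (pi - 2 * ?\<psi>) =
          \<beta> - 2 * v * (real (k t) / t) + of_int (int (k t) * int m) * (2 * pi / real n)"
        using elim(3) n by (simp add: field_simps)
      also have "\<dots> = \<beta> - 2 * v * (real (k t) / t) + of_int j * (2 * pi / real n) + of_int q * (2 * pi)"
        using n unfolding q by (simp add: field_simps)
      finally show ?thesis using elim(1) per by (simp only:)
    qed
    ultimately show "\<not> survives H t \<beta> ?\<psi>" unfolding survives_def by blast
  qed
qed

text \<open>
  Modulo \<open>2 \<pi> / n\<close> the orbit stays on the limit segment, prolonged by a factor that tends to \<open>1\<close>. A compact
  segment has positive distance from a disjoint closed set, so for large \<open>t\<close> the prolonged one avoids
  it too.
\<close>

lemma eventually_survives:
  fixes m n :: nat and H K :: "real set" and v \<beta> :: real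
  defines "c \<equiv> sin (pi * real m / real n)"
  assumes K: "closed K" "fold_set n H \<subseteq> K" and n: "n > 0" and c: "c > 0"
    and disj: "closed_segment \<beta> (\<beta> - v / c) \<inter> K = {}"
  shows "\<forall>\<^sub>F t in at_top. survives H t \<beta> (pi / 2 - pi * real m / real n + v / t)"
proof -
  obtain r where r: "r > 0" "\<And>x y. x \<in> closed_segment \<beta> (\<beta> - v / c) \<Longrightarrow> y \<in> K \<Longrightarrow> r \<le> dist x y"
    using separate_compact_closed[OF _ K(1) disj] by auto
  have vt: "((\<lambda>t. v / t) \<longlongrightarrow> 0) at_top"
    by (intro tendsto_divide_0[OF tendsto_const] filterlim_at_top_imp_at_infinity filterlim_ident)
  have sn: "((\<lambda>t. sin (pi * real m / real n - v / t)) \<longlongrightarrow> sin (pi * real m / real n - 0)) at_top"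
    by (intro tendsto_intros vt)
  hence sn: "((\<lambda>t. sin (pi * real m / real n - v / t)) \<longlongrightarrow> c) at_top" by (simp add: c_def)
  have "((\<lambda>t. \<bar>v / c\<bar> * \<bar>c / sin (pi * real m / real n - v / t) - 1\<bar>) \<longlongrightarrow> \<bar>v / c\<bar> * \<bar>c / c - 1\<bar>) at_top"
    by (intro tendsto_intros sn) (use c in auto)
  moreover have "\<bar>v / c\<bar> * \<bar>c / c - 1\<bar> < r" using c r by simp
  ultimately have ev1: "\<forall>\<^sub>F t in at_top. \<bar>v / c\<bar> * \<bar>c / sin (pi * real m / real n - v / t) - 1\<bar> < r"
    by (rule order_tendstoD(2))
  have ev2: "\<forall>\<^sub>F t in at_top. sin (pi * real m / real n - v / t) > 0"
    using sn c by (rule order_tendstoD(1))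
  show ?thesis using ev1 ev2 eventually_gt_at_top[of 0]
  proof eventually_elim
    case (elim t)
    let ?\<psi> = "pi / 2 - pi * real m / real n + v / t"
    define \<sigma> where "\<sigma> = sin (pi * real m / real n - v / t)"
    have "cos ?\<psi> = cos (pi / 2 - (pi * real m / real n - v / t))" by (simp add: algebra_simps)
    also have "\<dots> = \<sigma>" by (simp add: cos_diff \<sigma>_def)
    finally have cos: "cos ?\<psi> = \<sigma>" .
    show "survives H t \<beta> ?\<psi>" unfolding survives_def
    proof (intro allI impI notI)
      fix k :: nat
      assume k: "2 * cos ?\<psi> * real k \<le> t" and hit: "\<beta> + real k * (pi - 2 * ?\<psi>) \<in> H"
      define s where "s = 2 * c * real k / t"
      have s: "0 \<le> s" "s \<le> c / \<sigma>"
      proof -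
        have "\<sigma> > 0" using elim(2) by (simp add: \<sigma>_def)
        moreover have "c * (2 * \<sigma> * real k) \<le> c * t" using k c unfolding cos by simp
        ultimately show "s \<le> c / \<sigma>" using elim(3) by (simp add: s_def field_simps)
      qed (use c elim(3) in \<open>simp add: s_def\<close>)
      define w where "w = \<beta> - s * (v / c)"
      have "\<beta> + real k * (pi - 2 * ?\<psi>) = w + of_int (int k * int m) * (2 * pi / real n)"
        using c elim(3) n by (simp add: w_def s_def field_simps)
      hence "w \<in> K" using hit K(2) by (auto simp: fold_set_def simp del: of_int_mult)
      define p where "p = \<beta> - min s 1 * (v / c)"
      have "p \<in> closed_segment \<beta> (\<beta> - v / c)"
        unfolding in_segment using s
        by (intro exI[of _ "min s 1"]) (auto simp: p_def algebra_simps)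
      hence "r \<le> dist p w" using r(2) \<open>w \<in> K\<close> by blast
      also have "dist p w = \<bar>v / c * (min s 1 - s)\<bar>"
        by (simp add: p_def w_def dist_real_def right_diff_distrib mult.commute abs_minus_commute)
      also have "\<dots> = \<bar>v / c\<bar> * \<bar>s - min s 1\<bar>" by (simp only: abs_mult abs_minus_commute)
      also have "\<dots> \<le> \<bar>v / c\<bar> * \<bar>c / \<sigma> - 1\<bar>"
        using s by (intro mult_left_mono) auto
      also have "\<dots> < r" using elim(1) by (simp add: \<sigma>_def)
      finally show False by simp
    qed
  qed
qed

section \<open>Periodic integrals and gaps between arcs\<close>

text \<open>
  A start \<open>\<beta>\<close> inside the arc at \<open>p\<close> is blocked at once. From a start in the gap behind that arc, a
  segment that leaves the gap on either side runs into the arc there, because each end of the gap is an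
  end point of an open arc of positive length.
\<close>

lemma free_segments_within_gap:
  fixes p q d \<beta> :: real and S :: "real set"
  defines "G \<equiv> (\<Union>s\<in>S. {s<..<s + d})"
  assumes pq: "p \<in> S" "q \<in> S" "S \<inter> {p<..<q} = {}" and \<beta>: "p < \<beta>" "\<beta> < q" and d: "d > 0"
  shows "{y. closed_segment \<beta> y \<inter> G = {}} = (if p + d \<le> \<beta> then {p + d..q} else {})"
proof (cases "p + d \<le> \<beta>")
  case False
  hence "\<beta> \<in> G" using pq \<beta> by (auto simp: G_def)
  thus ?thesis using False by auto
next
  case True
  have free: "{p + d..q} \<inter> G = {}"
  proof -
    have False if "x \<in> {p + d..q}" "s \<in> S" "s < x" "x < s + d" for x s
    proof -
      have "s \<notin> {p<..<q}" using pq(3) that by auto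
      thus False using that by auto
    qed
    thus ?thesis by (fastforce simp: G_def)
  qed
  have "closed_segment \<beta> y \<inter> G = {} \<longleftrightarrow> y \<in> {p + d..q}" for y
  proof
    assume y: "y \<in> {p + d..q}"
    have "closed_segment \<beta> y \<subseteq> {p + d..q}" using y True \<beta>
      by (auto simp: closed_segment_eq_real_ivl split: if_splits)
    thus "closed_segment \<beta> y \<inter> G = {}" using free by auto
  next
    assume e: "closed_segment \<beta> y \<inter> G = {}"
    show "y \<in> {p + d..q}"
    proof (rule ccontr)
      assume "y \<notin> {p + d..q}"
      then consider "y < p + d" | "y > q" by force
      thus False
      proof cases
        case 1
        define z where "z = (max y p + p + d) / 2"
        have "z \<in> {p<..<p + d}" "y \<le> z" "z \<le> \<beta>" using 1 d True by (auto simp: z_def)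
        hence "z \<in> closed_segment \<beta> y \<inter> G" using pq(1)
          by (auto simp: G_def closed_segment_eq_real_ivl)
        thus False using e by blast
      next
        case 2
        define z where "z = (min y (q + d) + q) / 2"
        have "z \<in> {q<..<q + d}" "z \<le> y" "\<beta> \<le> z" using 2 d \<beta> by (auto simp: z_def)
        hence "z \<in> closed_segment \<beta> y \<inter> G" using pq(2)
          by (auto simp: G_def closed_segment_eq_real_ivl)
        thus False using e by blast
      qed
    qed
  qed
  thus ?thesis using True by auto
qed

text \<open>
  A gap of length \<open>L\<close> gives \<open>L\<close> for each of its points, hence \<open>L\<^sup>2\<close> in total. When neighbouring arcs
  overlap, \<open>q - p - d\<close> is negative and the truncated square gives \<open>0\<close>.
\<close>

lemma nn_integral_free_length_gap:
  fixes p q d :: real and S :: "real set"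
  defines "G \<equiv> (\<Union>s\<in>S. {s<..<s + d})"
  assumes pq: "p \<in> S" "q \<in> S" "S \<inter> {p<..<q} = {}" and d: "d > 0"
  shows "(\<integral>\<^sup>+\<beta>\<in>{p<..<q}. emeasure lborel {y. closed_segment \<beta> y \<inter> G = {}} \<partial>lborel)
    = ennreal (pos_square (q - p - d))"
proof -
  have "(\<integral>\<^sup>+\<beta>\<in>{p<..<q}. emeasure lborel {y. closed_segment \<beta> y \<inter> G = {}} \<partial>lborel)
    = (\<integral>\<^sup>+\<beta>. ennreal (q - p - d) * indicator {p + d..<q} \<beta> \<partial>lborel)"
  proof (intro nn_integral_cong)
    fix \<beta> :: real
    show "emeasure lborel {y. closed_segment \<beta> y \<inter> G = {}} * indicator {p<..<q} \<beta> =
      ennreal (q - p - d) * indicator {p + d..<q} \<beta>"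
    proof (cases "\<beta> \<in> {p<..<q}")
      case True
      thus ?thesis unfolding G_def using free_segments_within_gap[OF pq, of \<beta> d] d
        by (auto simp: indicator_def algebra_simps)
    next
      case False
      thus ?thesis using d by (auto simp: indicator_def)
    qed
  qed
  also have "\<dots> = ennreal (q - p - d) * emeasure lborel {p + d..<q}"
    by (simp add: nn_integral_cmult_indicator)
  also have "\<dots> = ennreal (pos_square (q - p - d))"
    by (cases "p + d \<le> q") (auto simp: pos_square_def power2_eq_square algebra_simps ennreal_neg simp flip: ennreal_mult')
  finally show ?thesis .
qed

lemma nn_integral_shift_interval:
  fixes f :: "real \<Rightarrow> ennreal"
  assumes [measurable]: "f \<in> borel_measurable borel" and per: "\<And>x. f (x + T) = f x"
  shows "(\<integral>\<^sup>+x\<in>{a + T<..b + T}. f x \<partial>lborel) = (\<integral>\<^sup>+x\<in>{a<..b}. f x \<partial>lborel)"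
proof -
  have "(\<integral>\<^sup>+x\<in>{a + T<..b + T}. f x \<partial>lborel) =
    (\<integral>\<^sup>+x. f (T + 1 * x) * indicator {a + T<..b + T} (T + 1 * x) \<partial>lborel)"
    by (subst nn_integral_real_affine[where c = 1 and t = T]) auto
  also have "\<dots> = (\<integral>\<^sup>+x\<in>{a<..b}. f x \<partial>lborel)"
    using per by (intro nn_integral_cong) (auto simp: indicator_def add.commute)
  finally show ?thesis .
qed

lemma nn_integral_split_interval:
  fixes f :: "real \<Rightarrow> ennreal"
  assumes [measurable]: "f \<in> borel_measurable borel" and "a \<le> b" "b \<le> c"
  shows "(\<integral>\<^sup>+x\<in>{a<..c}. f x \<partial>lborel) = (\<integral>\<^sup>+x\<in>{a<..b}. f x \<partial>lborel) + (\<integral>\<^sup>+x\<in>{b<..c}. f x \<partial>lborel)"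
  using assms(2,3) by (subst nn_integral_add[symmetric])
    (auto intro!: nn_integral_cong simp: indicator_def)

text \<open>
  The window is first moved by whole periods so that it starts at some \<open>r\<close> in \<open>[0, T)\<close>; its part beyond
  \<open>T\<close> is then moved back to \<open>(0, r]\<close>.
\<close>

lemma nn_integral_one_period:
  fixes f :: "real \<Rightarrow> ennreal"
  assumes f [measurable]: "f \<in> borel_measurable borel" and per: "\<And>x. f (x + T) = f x" and T: "T > 0"
  shows "(\<integral>\<^sup>+x\<in>{a<..a + T}. f x \<partial>lborel) = (\<integral>\<^sup>+x\<in>{0<..T}. f x \<partial>lborel)"
proof -
  have mult: "f (x + of_int j * T) = f x" for x and j :: int
  proof (induction j rule: int_induct[where k = 0])
    case (step1 i)
    thus ?case using per[of "x + of_int i * T"] by (simp add: algebra_simps)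
  next
    case (step2 i)
    thus ?case using per[of "x + of_int (i - 1) * T"] by (simp add: algebra_simps)
  qed simp
  define j where "j = \<lfloor>a / T\<rfloor>"
  define r where "r = a - of_int j * T"
  have "of_int j \<le> a / T" "a / T < of_int j + 1" by (simp_all add: j_def)
  hence r: "0 \<le> r" "r \<le> T" using T by (auto simp: r_def field_simps)
  have "(\<integral>\<^sup>+x\<in>{a<..a + T}. f x \<partial>lborel) = (\<integral>\<^sup>+x\<in>{r + of_int j * T<..(r + T) + of_int j * T}. f x \<partial>lborel)"
    by (simp add: r_def algebra_simps)
  also have "\<dots> = (\<integral>\<^sup>+x\<in>{r<..r + T}. f x \<partial>lborel)"
    by (rule nn_integral_shift_interval) (auto simp: mult)
  also have "\<dots> = (\<integral>\<^sup>+x\<in>{r<..T}. f x \<partial>lborel) + (\<integral>\<^sup>+x\<in>{0 + T<..r + T}. f x \<partial>lborel)"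
    using nn_integral_split_interval[OF f, of r T "r + T"] r by simp
  also have "(\<integral>\<^sup>+x\<in>{0 + T<..r + T}. f x \<partial>lborel) = (\<integral>\<^sup>+x\<in>{0<..r}. f x \<partial>lborel)"
    by (rule nn_integral_shift_interval) (auto simp: per)
  also have "(\<integral>\<^sup>+x\<in>{r<..T}. f x \<partial>lborel) + (\<integral>\<^sup>+x\<in>{0<..r}. f x \<partial>lborel) = (\<integral>\<^sup>+x\<in>{0<..T}. f x \<partial>lborel)"
    using nn_integral_split_interval[OF f, of 0 r T] r by (simp add: add.commute)
  finally show ?thesis .
qed

lemma nn_integral_periods:
  fixes f :: "real \<Rightarrow> ennreal"
  assumes f: "f \<in> borel_measurable borel" and per: "\<And>x. f (x + T) = f x" and T: "T > 0"
  shows "(\<integral>\<^sup>+x\<in>{a<..a + real n * T}. f x \<partial>lborel) = of_nat n * (\<integral>\<^sup>+x\<in>{0<..T}. f x \<partial>lborel)"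
proof (induction n)
  case 0
  show ?case by simp
next
  case (Suc n)
  have "(\<integral>\<^sup>+x\<in>{a<..a + real (Suc n) * T}. f x \<partial>lborel) =
    (\<integral>\<^sup>+x\<in>{a<..a + real n * T}. f x \<partial>lborel) +
    (\<integral>\<^sup>+x\<in>{a + real n * T<..(a + real n * T) + T}. f x \<partial>lborel)"
    using T by (subst nn_integral_split_interval[OF f, of a "a + real n * T"]) (auto simp: algebra_simps)
  also have "(\<integral>\<^sup>+x\<in>{a + real n * T<..(a + real n * T) + T}. f x \<partial>lborel) = (\<integral>\<^sup>+x\<in>{0<..T}. f x \<partial>lborel)"
    by (rule nn_integral_one_period[OF f per T])
  finally show ?case using Suc by (simp add: algebra_simps)
qed

section \<open>The folded holes\<close>

text \<open>
  The left end points of the folded arcs.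
\<close>

definition starts :: "nat \<Rightarrow> real \<Rightarrow> real set" where
  "starts n \<theta> = (\<Union>j::int. {of_int j * (2 * pi / real n), \<theta> + of_int j * (2 * pi / real n)})"

lemma fold_two_holes:
  assumes n: "n > 0"
  shows "fold_set n (two_holes \<theta> \<Delta>) = (\<Union>s\<in>starts n \<theta>. {s<..<s + \<Delta>})"
proof -
  let ?T = "2 * pi / real n"
  have arc: "{x. \<exists>j::int. x + of_int j * ?T \<in> arc_mod a \<Delta>} = (\<Union>j::int. {a + of_int j * ?T<..<a + of_int j * ?T + \<Delta>})"
    for a
  proof (intro equalityI subsetI)
    fix x assume "x \<in> {x. \<exists>j::int. x + of_int j * ?T \<in> arc_mod a \<Delta>}"
    then obtain j i :: int where "a < x + of_int j * ?T + of_int i * (2 * pi)"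
      "x + of_int j * ?T + of_int i * (2 * pi) < a + \<Delta>" by (auto simp: mem_arc_mod_iff)
    moreover have "of_int (-(j + i * int n)) * ?T = - (of_int j * ?T) - of_int i * (2 * pi)"
      using n by (simp add: field_simps)
    ultimately have "x \<in> {a + of_int (-(j + i * int n)) * ?T<..<a + of_int (-(j + i * int n)) * ?T + \<Delta>}"
      by (simp only: greaterThanLessThan_iff) linarith
    thus "x \<in> (\<Union>j::int. {a + of_int j * ?T<..<a + of_int j * ?T + \<Delta>})" by blast
  next
    fix x assume "x \<in> (\<Union>j::int. {a + of_int j * ?T<..<a + of_int j * ?T + \<Delta>})"
    then obtain j :: int where "a + of_int j * ?T < x" "x < a + of_int j * ?T + \<Delta>" by auto
    hence "x + of_int (-j) * ?T \<in> arc_mod a \<Delta>"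
      unfolding mem_arc_mod_iff by (intro exI[of _ 0]) auto
    thus "x \<in> {x. \<exists>j::int. x + of_int j * ?T \<in> arc_mod a \<Delta>}" by blast
  qed
  have "fold_set n (two_holes \<theta> \<Delta>) = {x. \<exists>j::int. x + of_int j * ?T \<in> arc_mod 0 \<Delta>} \<union>
      {x. \<exists>j::int. x + of_int j * ?T \<in> arc_mod \<theta> \<Delta>}"
    by (auto simp: fold_set_def two_holes_def)
  also have "\<dots> = (\<Union>s\<in>starts n \<theta>. {s<..<s + \<Delta>})"
    unfolding arc by (auto simp: starts_def)
  finally show ?thesis .
qed

lemma starts_rmod:
  assumes n: "n > 0"
  shows "starts n (\<theta> rmod (2 * pi / real n)) = starts n \<theta>"
proof -
  let ?T = "2 * pi / real n"
  define q where "q = \<lfloor>\<theta> / ?T\<rfloor>"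
  have q: "\<theta> rmod ?T = \<theta> - of_int q * ?T" using n by (simp add: rmod_def q_def)
  have "range (\<lambda>j::int. \<theta> rmod ?T + of_int j * ?T) = (\<lambda>j. \<theta> + of_int j * ?T) ` range (\<lambda>j. j - q)"
    unfolding q image_image by (intro image_cong refl) (simp add: algebra_simps diff_divide_distrib)
  also have "range (\<lambda>j. j - q) = UNIV" by (rule surj_diff_right)
  finally have "range (\<lambda>j::int. \<theta> rmod ?T + of_int j * ?T) = range (\<lambda>j. \<theta> + of_int j * ?T)" .
  moreover have "starts n a = range (\<lambda>j::int. of_int j * ?T) \<union> range (\<lambda>j. a + of_int j * ?T)" for a
    by (auto simp: starts_def)
  ultimately show ?thesis by (simp only:)
qed

text \<open>
  The complement is a union, over the parameters \<open>u\<close> in \<open>[0, 1]\<close>, of preimages of \<open>G\<close> under continuous maps.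
\<close>

lemma closed_free_pairs:
  fixes G :: "real set"
  assumes "open G"
  shows "closed {(x, y). closed_segment x y \<inter> G = {}}"
proof -
  have "- {(x, y). closed_segment x y \<inter> G = {}} =
    (\<Union>u\<in>{0..1}. (\<lambda>z. (1 - u) * fst z + u * snd z) -` G)"
    by (auto simp: closed_segment_def) blast+
  also have "open \<dots>" using assms by (intro open_UN ballI open_vimage continuous_intros) auto
  finally show ?thesis by (simp add: closed_def)
qed

lemma sets_free_endpoints:
  fixes G :: "real set"
  assumes "open G"
  shows "{y. closed_segment x y \<inter> G = {}} \<in> sets borel"
proof -
  have "closed ((\<lambda>y. (x, y)) -` {(x, y). closed_segment x y \<inter> G = {}})"
    by (intro closed_vimage closed_free_pairs assms continuous_intros)
  hence "(\<lambda>y. (x, y)) -` {(x, y). closed_segment x y \<inter> G = {}} \<in> sets borel" by (rule borel_closed)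
  thus ?thesis by (simp add: vimage_def)
qed

lemma free_translate:
  fixes \<beta> y T :: real
  assumes perG: "(\<lambda>x. x + T) -` G = G"
  shows "closed_segment (\<beta> + T) (T + y) \<inter> G = {} \<longleftrightarrow> closed_segment \<beta> y \<inter> G = {}"
proof -
  have "closed_segment (\<beta> + T) (T + y) = (\<lambda>x. x + T) ` closed_segment \<beta> y"
    using closed_segment_translation[of T \<beta> y] by (simp add: add.commute)
  moreover have "(\<lambda>x. x + T) ` closed_segment \<beta> y \<inter> G = {} \<longleftrightarrow> closed_segment \<beta> y \<inter> (\<lambda>x. x + T) -` G = {}" by blast
  ultimately show ?thesis by (simp only: perG)
qed

lemma free_length_translate:
  fixes T :: real
  assumes per: "(\<lambda>x. x + T) -` G = G" and meas: "\<And>x. {y. closed_segment x y \<inter> G = {}} \<in> sets borel"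
  shows "emeasure lborel {y. closed_segment (x + T) y \<inter> G = {}} = emeasure lborel {y. closed_segment x y \<inter> G = {}}"
proof -
  let ?Y = "\<lambda>\<beta>. {y. closed_segment \<beta> y \<inter> G = {}}"
  have "emeasure lborel (?Y (x + T)) = (\<integral>\<^sup>+y. indicator (?Y (x + T)) y \<partial>lborel)"
    using meas by (intro nn_integral_indicator[symmetric]) simp
  also have "\<dots> = (\<integral>\<^sup>+y. indicator (?Y (x + T)) (T + 1 * y) \<partial>lborel)"
    using nn_integral_real_affine[of "indicator (?Y (x + T))" 1 T] meas[of "x + T"] by simp
  also have "\<dots> = (\<integral>\<^sup>+y. indicator (?Y x) y \<partial>lborel)"
    by (intro nn_integral_cong) (simp add: indicator_def free_translate[OF per])
  also have "\<dots> = emeasure lborel (?Y x)"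
    using meas by (intro nn_integral_indicator) simp
  finally show ?thesis .
qed
lemma borel_measurable_free_length [measurable]:
  fixes G :: "real set"
  assumes "open G"
  shows "(\<lambda>x. emeasure lborel {y. closed_segment x y \<inter> G = {}}) \<in> borel_measurable borel"
proof -
  have "{(x, y). closed_segment x y \<inter> G = {}} \<in> sets (lborel \<Otimes>\<^sub>M lborel)"
    unfolding lborel_prod using closed_free_pairs[OF assms] by simp
  from lborel.measurable_emeasure_Pair[OF this] show ?thesis
    by (simp add: vimage_def)
qed

text \<open>
  In one period \<open>T = 2 \<pi> / n\<close> the consecutive arcs start at \<open>0\<close>, \<open>\<theta>'\<close> and \<open>T\<close>, which leaves two gaps. The interval
  \<open>(-\<pi>, \<pi>]\<close> consists of \<open>n\<close> periods.
\<close>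

lemma nn_integral_free_length:
  fixes \<theta> \<Delta> :: real and n :: nat
  defines "\<theta>' \<equiv> \<theta> rmod (2 * pi / real n)"
  assumes n: "n > 0" and \<Delta>: "\<Delta> > 0"
  shows "(\<integral>\<^sup>+\<beta>\<in>{-pi<..pi}. emeasure lborel
            {y. closed_segment \<beta> y \<inter> fold_set n (two_holes \<theta> \<Delta>) = {}} \<partial>lborel)
    = ennreal (real n * (pos_square (2 * pi / real n - \<theta>' - \<Delta>) + pos_square (\<theta>' - \<Delta>)))"
proof -
  define T where "T = 2 * pi / real n"
  have T: "T > 0" using n by (simp add: T_def)
  define G where "G = fold_set n (two_holes \<theta> \<Delta>)"
  define W where "W \<beta> = emeasure lborel {y. closed_segment \<beta> y \<inter> G = {}}" for \<beta>
  define S where "S = starts n \<theta>'"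
  have "\<theta>' = \<theta> rmod T" by (simp add: \<theta>'_def T_def)
  hence \<theta>': "0 \<le> \<theta>'" "\<theta>' < T"
    using T rmod_nonneg[of T \<theta>] rmod_less[of T \<theta>] by simp_all
  have G: "G = (\<Union>s\<in>S. {s<..<s + \<Delta>})"
    using n by (simp add: G_def S_def \<theta>'_def fold_two_holes starts_rmod)
  have W [measurable]: "W \<in> borel_measurable borel"
    unfolding W_def by (rule borel_measurable_free_length) (simp add: G_def open_fold_set open_two_holes)
  have perG: "(\<lambda>x. x + T) -` G = G" by (auto simp: G_def T_def)
  have perW: "W (\<beta> + T) = W \<beta>" for \<beta>
  proof -
    have "open G" by (simp add: G_def open_fold_set open_two_holes)
    from free_length_translate[OF perG sets_free_endpoints[OF this]]
    show ?thesis unfolding W_def by this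
  qed
  have gap: "(\<integral>\<^sup>+\<beta>\<in>{p<..q}. W \<beta> \<partial>lborel) = ennreal (pos_square (q - p - \<Delta>))"
    if pq: "p \<in> S" "q \<in> S" "S \<inter> {p<..<q} = {}" for p q
  proof -
    have "(\<integral>\<^sup>+\<beta>\<in>{p<..q}. W \<beta> \<partial>lborel) = (\<integral>\<^sup>+\<beta>\<in>{p<..<q}. W \<beta> \<partial>lborel)"
    proof (rule nn_integral_cong_AE)
      show "AE \<beta> in lborel. W \<beta> * indicator {p<..q} \<beta> = W \<beta> * indicator {p<..<q} \<beta>"
        using AE_lborel_singleton[of q]
        by eventually_elim (simp add: indicator_def less_le)
    qed
    also have "\<dots> = ennreal (pos_square (q - p - \<Delta>))"
      unfolding W_def G by (rule nn_integral_free_length_gap[OF pq \<Delta>])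
    finally show ?thesis .
  qed
  have Smem: "0 \<in> S" "\<theta>' \<in> S" "T \<in> S"
    unfolding S_def starts_def T_def[symmetric]
    by (auto intro: exI[of _ 0] exI[of _ 1])
  have Sform: "\<exists>j::int. s = of_int j * T \<or> s = \<theta>' + of_int j * T" if "s \<in> S" for s
    using that unfolding S_def starts_def T_def[symmetric] by auto
  have Sgap: "s = \<theta>'" if s: "s \<in> S" "0 < s" "s < T" for s
  proof -
    obtain j :: int where j: "s = of_int j * T \<or> s = \<theta>' + of_int j * T" using Sform s by blast
    have "-1 < j \<and> j < 1 \<or> j = 0"
    proof -
      have "real_of_int j * T < 1 * T" "(-1) * T < real_of_int j * T"
        using j s \<theta>' T by (elim disjE; simp only: mult_1 mult_minus1; linarith)+
      hence "real_of_int j < 1" "-1 < real_of_int j"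
        by (simp_all only: mult_less_cancel_right_pos[OF T])
      thus ?thesis by linarith
    qed
    hence "j = 0" by auto
    thus ?thesis using j s by auto
  qed
  have "(\<integral>\<^sup>+\<beta>\<in>{-pi<..pi}. W \<beta> \<partial>lborel) = (\<integral>\<^sup>+\<beta>\<in>{-pi<..-pi + real n * T}. W \<beta> \<partial>lborel)"
    using n by (simp add: T_def)
  also have "\<dots> = of_nat n * (\<integral>\<^sup>+\<beta>\<in>{0<..T}. W \<beta> \<partial>lborel)"
    by (rule nn_integral_periods[OF W perW T])
  also have "(\<integral>\<^sup>+\<beta>\<in>{0<..T}. W \<beta> \<partial>lborel) =
    (\<integral>\<^sup>+\<beta>\<in>{0<..\<theta>'}. W \<beta> \<partial>lborel) + (\<integral>\<^sup>+\<beta>\<in>{\<theta>'<..T}. W \<beta> \<partial>lborel)"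
    using \<theta>' by (intro nn_integral_split_interval[OF W]) auto
  also have "(\<integral>\<^sup>+\<beta>\<in>{0<..\<theta>'}. W \<beta> \<partial>lborel) = ennreal (pos_square (\<theta>' - 0 - \<Delta>))"
    using Smem Sgap \<theta>' by (intro gap) force+
  also have "(\<integral>\<^sup>+\<beta>\<in>{\<theta>'<..T}. W \<beta> \<partial>lborel) = ennreal (pos_square (T - \<theta>' - \<Delta>))"
    using Smem Sgap \<theta>' by (intro gap) force+
  also have "of_nat n * (ennreal (pos_square (\<theta>' - 0 - \<Delta>)) + ennreal (pos_square (T - \<theta>' - \<Delta>)))
    = ennreal (real n * (pos_square (T - \<theta>' - \<Delta>) + pos_square (\<theta>' - \<Delta>)))"
    by (simp add: pos_square_def ennreal_mult' flip: ennreal_plus ennreal_of_nat_eq_real_of_nat)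
      (simp add: ennreal_mult' ennreal_of_nat_eq_real_of_nat add.commute)
  finally show ?thesis unfolding W_def G_def T_def .
qed

text \<open>
  The family of arcs is locally finite: the closed arcs form the sum of a closed discrete group and a
  compact set, which is closed. So only the end points of the arcs are added by the closure.
\<close>

lemma countable_frontier_fold_two_holes:
  assumes n: "n > 0"
  shows "countable (closure (fold_set n (two_holes \<theta> \<Delta>)) - fold_set n (two_holes \<theta> \<Delta>))"
proof -
  let ?T = "2 * pi / real n"
  define Z where "Z = range (\<lambda>j::int. of_int j * ?T)"
  define C where "C = {0..\<Delta>} \<union> {\<theta>..\<theta> + \<Delta>}"
  define K where "K = (\<Union>x\<in>Z. \<Union>y\<in>C. {x + y})"
  have "Z = (\<lambda>x. ?T *\<^sub>R x) ` \<int>" by (auto simp: Z_def Ints_def image_image mult.commute)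
  hence "closed Z" using closed_scaling[OF closed_Ints, of ?T] by (simp only:)
  moreover have "compact C" by (simp add: C_def compact_Un)
  ultimately have cK: "closed K" unfolding K_def by (rule closed_compact_sums)
  have G: "fold_set n (two_holes \<theta> \<Delta>) = (\<Union>s\<in>starts n \<theta>. {s<..<s + \<Delta>})"
    using n by (rule fold_two_holes)
  have "fold_set n (two_holes \<theta> \<Delta>) \<subseteq> K"
  proof
    fix x assume "x \<in> fold_set n (two_holes \<theta> \<Delta>)"
    then obtain s where s: "s \<in> starts n \<theta>" "s < x" "x < s + \<Delta>" unfolding G by auto
    then obtain j :: int where "s = of_int j * ?T \<or> s = \<theta> + of_int j * ?T"
      by (auto simp: starts_def)
    hence "x - of_int j * ?T \<in> C" using s unfolding C_def by (elim disjE) simp_all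
    moreover have "x = of_int j * ?T + (x - of_int j * ?T)" by simp
    ultimately show "x \<in> K" unfolding K_def Z_def by blast
  qed
  hence "closure (fold_set n (two_holes \<theta> \<Delta>)) \<subseteq> K" using cK by (rule closure_minimal)
  hence "closure (fold_set n (two_holes \<theta> \<Delta>)) - fold_set n (two_holes \<theta> \<Delta>) \<subseteq> K - fold_set n (two_holes \<theta> \<Delta>)"
    by (rule Diff_mono) (rule order_refl)
  also have "K - fold_set n (two_holes \<theta> \<Delta>) \<subseteq>
    (\<Union>s\<in>starts n \<theta>. {s, s + \<Delta>})"
  proof
    fix x assume x: "x \<in> K - fold_set n (two_holes \<theta> \<Delta>)"
    then obtain j :: int and y where y: "x = of_int j * ?T + y" "y \<in> C"
      by (auto simp: K_def Z_def)
    then obtain s where s: "s \<in> starts n \<theta>" "s \<le> x" "x \<le> s + \<Delta>"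
    proof (cases "y \<in> {0..\<Delta>}")
      case True
      thus ?thesis using y that[of "of_int j * ?T"] by (auto simp: starts_def)
    next
      case False
      thus ?thesis using y that[of "\<theta> + of_int j * ?T"] by (auto simp: starts_def C_def)
    qed
    hence "x = s \<or> x = s + \<Delta>" using x unfolding G by force
    thus "x \<in> (\<Union>s\<in>starts n \<theta>. {s, s + \<Delta>})" using s by auto
  qed
  finally have "closure (fold_set n (two_holes \<theta> \<Delta>)) - fold_set n (two_holes \<theta> \<Delta>) \<subseteq>
    (\<Union>s\<in>starts n \<theta>. {s, s + \<Delta>})" .
  moreover have "countable (\<Union>s\<in>starts n \<theta>. {s, s + \<Delta>})"
    unfolding starts_def by (intro countable_UN) auto
  ultimately show ?thesis by (rule countable_subset)
qed

section \<open>Magnifying the phase space near a periodic angle\<close>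

lemma sets_phase_space [measurable]: "phase_space \<in> sets borel"
  unfolding phase_space_def by (intro borel_Times) auto

lemma measurable_density_fun [measurable]:
  "(\<lambda>(\<beta>::real, \<psi>). ennreal (cos \<psi> / (4 * pi))) \<in> borel_measurable borel"
  unfolding borel_prod[symmetric] by measurable

lemma sets_survives [measurable]:
  assumes H: "open H"
  shows "{x. survives H t (fst x) (snd x)} \<in> sets borel"
proof -
  have [measurable]: "H \<in> sets borel" using H by simp
  have "{x \<in> space borel. survives H t (fst x) (snd x)} \<in> sets (borel \<Otimes>\<^sub>M borel)"
    unfolding survives_def borel_prod[symmetric] by measurable
  thus ?thesis unfolding borel_prod space_borel by simp
qed

lemma emeasure_billiard:
  assumes A: "A \<in> sets borel" "A \<subseteq> phase_space"
  shows "emeasure billiard_measure A =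
    (\<integral>\<^sup>+\<beta>. \<integral>\<^sup>+\<psi>. ennreal (cos \<psi> / (4 * pi)) * indicator A (\<beta>, \<psi>) \<partial>lborel \<partial>lborel)"
proof -
  have [measurable]: "A \<in> sets borel" "A \<in> sets (restrict_space borel phase_space)"
    using A by (auto simp: sets_restrict_space_iff)
  have [measurable]: "A \<in> sets (lborel \<Otimes>\<^sub>M lborel)" unfolding lborel_prod using A by simp
  have [measurable]: "(\<lambda>(\<beta>::real, \<psi>). ennreal (cos \<psi> / (4 * pi))) \<in> borel_measurable (restrict_space lborel phase_space)"
    using measurable_restrict_space1[OF measurable_density_fun] 
    by (simp cong: measurable_cong_sets)
  have "emeasure billiard_measure A =
    (\<integral>\<^sup>+x. (case x of (\<beta>, \<psi>) \<Rightarrow> ennreal (cos \<psi> / (4 * pi))) * indicator A x \<partial>restrict_space lborel phase_space)"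
    unfolding billiard_measure_def
    by (subst emeasure_density) (auto simp: sets_restrict_space_iff A)
  also have "\<dots> = (\<integral>\<^sup>+x. (case x of (\<beta>, \<psi>) \<Rightarrow> ennreal (cos \<psi> / (4 * pi))) * indicator A x \<partial>lborel)"
    using A(2) by (subst nn_integral_restrict_space) (auto intro!: nn_integral_cong simp: indicator_def)
  also have "\<dots> = (\<integral>\<^sup>+x. ennreal (cos (snd x) / (4 * pi)) * indicator A x \<partial>(lborel \<Otimes>\<^sub>M lborel))"
    by (simp add: lborel_prod case_prod_unfold)
  also have "\<dots> = (\<integral>\<^sup>+\<beta>. \<integral>\<^sup>+\<psi>. ennreal (cos \<psi> / (4 * pi)) * indicator A (\<beta>, \<psi>) \<partial>lborel \<partial>lborel)"
    by (subst lborel.nn_integral_fst[symmetric]) (auto simp: borel_prod)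
  finally show ?thesis .
qed

text \<open>
  The density of \<open>t\<close> times the measure of the survivors in the window of radius \<open>10 / t\<close> around \<open>\<psi>\<^sub>0\<close>, in
  the coordinates \<open>(\<beta>, v)\<close> with \<open>\<psi> = \<psi>\<^sub>0 + v / t\<close>; the Jacobian \<open>1 / t\<close> cancels the factor \<open>t\<close>.
\<close>

definition rescaled_density ::
    "real set \<Rightarrow> real \<Rightarrow> real \<Rightarrow> real \<times> real \<Rightarrow> real" where
  "rescaled_density H \<psi>\<^sub>0 t x = cos (\<psi>\<^sub>0 + snd x / t) / (4 * pi) *
     indicator {x. fst x \<in> {-pi<..pi} \<and> \<bar>snd x\<bar> \<le> 10 \<and> survives H t (fst x) (\<psi>\<^sub>0 + snd x / t)} x"

lemma borel_measurable_rescaled_density: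
  assumes H: "open H"
  shows "rescaled_density H \<psi>\<^sub>0 t \<in> borel_measurable (lborel \<Otimes>\<^sub>M lborel)"
proof -
  have [measurable]: "H \<in> sets borel" using H by simp
  show ?thesis
    unfolding rescaled_density_def survives_def indicator_def by measurable
qed

text \<open>
  Fubini and the substitution \<open>\<psi> = \<psi>\<^sub>0 + v / t\<close>. The bound on \<open>\<psi>\<^sub>0\<close> keeps the whole window inside the
  phase space, where the cosine is nonnegative.
\<close>

lemma measure_window_eq_integral:
  assumes H: "open H" and per: "\<And>x (j::int). x + of_int j * (2 * pi) \<in> H \<longleftrightarrow> x \<in> H"
    and t: "t > 0" and \<psi>: "\<bar>\<psi>\<^sub>0\<bar> + 10 / t \<le> pi / 2"
  shows "t * measure billiard_measure (nonescaping H t \<inter> {x. \<bar>snd x - \<psi>\<^sub>0\<bar> \<le> 10 / t}) =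
    (\<integral>x. rescaled_density H \<psi>\<^sub>0 t x \<partial>(lborel \<Otimes>\<^sub>M lborel))"
proof -
  define A where "A = nonescaping H t \<inter> {x. \<bar>snd x - \<psi>\<^sub>0\<bar> \<le> 10 / t}"
  have ps: "(\<beta>, \<psi>) \<in> phase_space \<longleftrightarrow> \<beta> \<in> {-pi<..pi}" if "\<bar>\<psi> - \<psi>\<^sub>0\<bar> \<le> 10 / t" for \<beta> \<psi>
    using that \<psi> by (auto simp: phase_space_def)
  have A_eq: "A = {x. fst x \<in> {-pi<..pi}} \<inter> {x. survives H t (fst x) (snd x)} \<inter> {x. \<bar>snd x - \<psi>\<^sub>0\<bar> \<le> 10 / t}"
  proof (intro set_eqI)
    fix x :: "real \<times> real"
    obtain \<beta> \<psi> where x: "x = (\<beta>, \<psi>)" by fastforce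
    show "x \<in> A \<longleftrightarrow> x \<in> {x. fst x \<in> {-pi<..pi}} \<inter> {x. survives H t (fst x) (snd x)} \<inter> {x. \<bar>snd x - \<psi>\<^sub>0\<bar> \<le> 10 / t}"
      using ps[of \<psi> \<beta>] nonescaping_iff_survives[OF per, of \<beta> \<psi> t]
      by (auto simp: A_def x nonescaping_def)
  qed
  have [measurable]: "A \<in> sets borel"
  proof -
    have "{x::real\<times>real. fst x \<in> {-pi<..pi}} = {-pi<..pi} \<times> UNIV" by auto
    moreover have "{-pi<..pi} \<times> (UNIV::real set) \<in> sets borel" by (intro borel_Times) auto
    moreover have "closed {x::real\<times>real. \<bar>snd x - \<psi>\<^sub>0\<bar> \<le> 10 / t}"
      by (intro closed_Collect_le continuous_intros)
    ultimately show ?thesis unfolding A_eq using sets_survives[OF H, of t] by auto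
  qed
  have sub: "A \<subseteq> phase_space" by (auto simp: A_def nonescaping_def)
  have pt: "ennreal (cos (\<psi>\<^sub>0 + (1 / t) * v) / (4 * pi)) * indicator A (\<beta>, \<psi>\<^sub>0 + (1 / t) * v) =
      ennreal (rescaled_density H \<psi>\<^sub>0 t (\<beta>, v))" for \<beta> v
  proof -
    have "\<bar>\<psi>\<^sub>0 + (1 / t) * v - \<psi>\<^sub>0\<bar> \<le> 10 / t \<longleftrightarrow> \<bar>v\<bar> \<le> 10" using t by (simp add: abs_mult field_simps)
    hence "(\<beta>, \<psi>\<^sub>0 + (1 / t) * v) \<in> A \<longleftrightarrow>
      \<beta> \<in> {-pi<..pi} \<and> \<bar>v\<bar> \<le> 10 \<and> survives H t \<beta> (\<psi>\<^sub>0 + v / t)"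
      unfolding A_eq by auto
    thus ?thesis by (auto simp: rescaled_density_def indicator_def)
  qed
  have inner: "(\<integral>\<^sup>+\<psi>. ennreal (cos \<psi> / (4 * pi)) * indicator A (\<beta>, \<psi>) \<partial>lborel) =
    ennreal (1 / t) * (\<integral>\<^sup>+v. ennreal (rescaled_density H \<psi>\<^sub>0 t (\<beta>, v)) \<partial>lborel)" for \<beta>
    using t by (subst nn_integral_real_affine[where c = "1 / t" and t = \<psi>\<^sub>0])
      (auto simp: pt[simplified])
  have meas [measurable]: "rescaled_density H \<psi>\<^sub>0 t \<in> borel_measurable (lborel \<Otimes>\<^sub>M lborel)"
    by (rule borel_measurable_rescaled_density[OF H])
  have "emeasure billiard_measure A =
    (\<integral>\<^sup>+\<beta>. ennreal (1 / t) * (\<integral>\<^sup>+v. ennreal (rescaled_density H \<psi>\<^sub>0 t (\<beta>, v)) \<partial>lborel) \<partial>lborel)"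
    by (subst emeasure_billiard[OF _ sub]) (simp_all add: inner)
  also have "\<dots> = ennreal (1 / t) * (\<integral>\<^sup>+\<beta>. \<integral>\<^sup>+v. ennreal (rescaled_density H \<psi>\<^sub>0 t (\<beta>, v)) \<partial>lborel \<partial>lborel)"
    by (intro nn_integral_cmult) measurable
  also have "(\<integral>\<^sup>+\<beta>. \<integral>\<^sup>+v. ennreal (rescaled_density H \<psi>\<^sub>0 t (\<beta>, v)) \<partial>lborel \<partial>lborel) =
    (\<integral>\<^sup>+x. ennreal (rescaled_density H \<psi>\<^sub>0 t x) \<partial>(lborel \<Otimes>\<^sub>M lborel))"
    using lborel.nn_integral_fst[of "\<lambda>x. ennreal (rescaled_density H \<psi>\<^sub>0 t x)" lborel] by simp
  finally have "measure billiard_measure A =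
    1 / t * enn2real (\<integral>\<^sup>+x. ennreal (rescaled_density H \<psi>\<^sub>0 t x) \<partial>(lborel \<Otimes>\<^sub>M lborel))"
    using t by (simp add: measure_def enn2real_mult)
  also have "enn2real (\<integral>\<^sup>+x. ennreal (rescaled_density H \<psi>\<^sub>0 t x) \<partial>(lborel \<Otimes>\<^sub>M lborel)) =
    (\<integral>x. rescaled_density H \<psi>\<^sub>0 t x \<partial>(lborel \<Otimes>\<^sub>M lborel))"
  proof (rule integral_eq_nn_integral[symmetric])
    show "AE x in lborel \<Otimes>\<^sub>M lborel. 0 \<le> rescaled_density H \<psi>\<^sub>0 t x"
    proof (rule AE_I2)
      fix x :: "real \<times> real"
      show "0 \<le> rescaled_density H \<psi>\<^sub>0 t x"
      proof (cases "\<bar>snd x\<bar> \<le> 10")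
        case True
        hence "\<bar>snd x / t\<bar> \<le> 10 / t" using t by (simp add: abs_divide divide_right_mono)
        hence "cos (\<psi>\<^sub>0 + snd x / t) \<ge> 0" using \<psi> by (intro cos_ge_zero) linarith+
        thus ?thesis by (simp add: rescaled_density_def)
      qed (simp add: rescaled_density_def)
    qed
  qed (rule meas)
  finally show ?thesis using t by (simp add: A_def)
qed

section \<open>The contribution of one periodic angle\<close>

text \<open>
  The pairs of starting point and magnified angle whose limit orbit survives.
\<close>

definition free_drifts :: "nat \<Rightarrow> real set \<Rightarrow> real \<Rightarrow> (real \<times> real) set" where
  "free_drifts n H c = {(\<beta>, v). \<beta> \<in> {-pi<..pi} \<and> closed_segment \<beta> (\<beta> - v / c) \<inter> fold_set n H = {}}"

lemma sets_free_drifts: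
  assumes H: "open H" and c: "c \<noteq> 0"
  shows "free_drifts n H c \<in> sets (lborel \<Otimes>\<^sub>M lborel)"
proof -
  let ?D = "{(x, y). closed_segment x y \<inter> fold_set n H = {}}"
  have "closed ((\<lambda>z::real\<times>real. (fst z, fst z - snd z / c)) -` ?D)"
    using c by (intro closed_vimage closed_free_pairs open_fold_set H continuous_intros) auto
  hence "(\<lambda>z::real\<times>real. (fst z, fst z - snd z / c)) -` ?D \<in> sets borel" by simp
  moreover have "{-pi<..pi} \<times> (UNIV :: real set) \<in> sets borel" by (intro borel_Times) auto
  moreover have "free_drifts n H c = (\<lambda>z. (fst z, fst z - snd z / c)) -` ?D \<inter> {-pi<..pi} \<times> UNIV"
    by (auto simp: free_drifts_def)
  ultimately show ?thesis unfolding lborel_prod by simp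
qed

text \<open>
  For fixed \<open>\<beta>\<close> the substitution \<open>y = \<beta> - v / c\<close> turns the length of the slice into \<open>c\<close> times the length
  reachable from \<open>\<beta>\<close>.
\<close>

lemma emeasure_free_drifts:
  fixes \<theta> \<Delta> c :: real and n :: nat
  defines "\<theta>' \<equiv> \<theta> rmod (2 * pi / real n)"
  assumes n: "n > 0" and \<Delta>: "\<Delta> > 0" and c: "c > 0"
  shows "emeasure (lborel \<Otimes>\<^sub>M lborel) (free_drifts n (two_holes \<theta> \<Delta>) c) =
    ennreal (c * (real n * (pos_square (2 * pi / real n - \<theta>' - \<Delta>) + pos_square (\<theta>' - \<Delta>))))"
proof -
  let ?G = "fold_set n (two_holes \<theta> \<Delta>)"
  let ?W = "\<lambda>\<beta>. emeasure lborel {y. closed_segment \<beta> y \<inter> ?G = {}}"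
  have G: "open ?G" by (simp add: open_fold_set open_two_holes)
  have meas: "{y. closed_segment \<beta> y \<inter> ?G = {}} \<in> sets borel" for \<beta>
    by (rule sets_free_endpoints[OF G])
  have slice: "emeasure lborel (Pair \<beta> -` free_drifts n (two_holes \<theta> \<Delta>) c) =
      ennreal c * (?W \<beta> * indicator {-pi<..pi} \<beta>)" for \<beta>
  proof (cases "\<beta> \<in> {-pi<..pi}")
    case True
    let ?Y = "{y. closed_segment \<beta> y \<inter> ?G = {}}"
    have "?W \<beta> = (\<integral>\<^sup>+y. indicator ?Y y \<partial>lborel)" using meas by simp
    also have "\<dots> = ennreal (1 / c) * (\<integral>\<^sup>+v. indicator ?Y (\<beta> + (- 1 / c) * v) \<partial>lborel)"
      using meas c by (subst nn_integral_real_affine[where c = "- 1 / c" and t = \<beta>]) auto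
    also have "(\<integral>\<^sup>+v. indicator ?Y (\<beta> + (- 1 / c) * v) \<partial>lborel) =
        (\<integral>\<^sup>+v. indicator (Pair \<beta> -` free_drifts n (two_holes \<theta> \<Delta>) c) v \<partial>lborel)"
      using True by (intro nn_integral_cong) (auto simp: indicator_def free_drifts_def)
    also have "\<dots> = emeasure lborel (Pair \<beta> -` free_drifts n (two_holes \<theta> \<Delta>) c)"
      using sets_Pair1[OF sets_free_drifts[OF open_two_holes, of c n \<theta> \<Delta>]] c by simp
    finally have "ennreal c * ?W \<beta> =
        ennreal c * ennreal (1 / c) * emeasure lborel (Pair \<beta> -` free_drifts n (two_holes \<theta> \<Delta>) c)"
      by (simp add: mult.assoc)
    also have "ennreal c * ennreal (1 / c) = 1" using c by (simp flip: ennreal_mult')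
    finally show ?thesis using True by simp
  next
    case False
    hence "Pair \<beta> -` free_drifts n (two_holes \<theta> \<Delta>) c = {}" by (auto simp: free_drifts_def)
    thus ?thesis using False by simp
  qed
  have W [measurable]: "?W \<in> borel_measurable borel"
    by (rule borel_measurable_free_length[OF G])
  have "emeasure (lborel \<Otimes>\<^sub>M lborel) (free_drifts n (two_holes \<theta> \<Delta>) c) =
    (\<integral>\<^sup>+\<beta>. emeasure lborel (Pair \<beta> -` free_drifts n (two_holes \<theta> \<Delta>) c) \<partial>lborel)"
    using c by (intro lborel.emeasure_pair_measure_alt sets_free_drifts open_two_holes) auto
  also have "\<dots> = ennreal c * (\<integral>\<^sup>+\<beta>\<in>{-pi<..pi}. ?W \<beta> \<partial>lborel)"
    unfolding slice by (rule nn_integral_cmult) measurable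
  also have "(\<integral>\<^sup>+\<beta>\<in>{-pi<..pi}. ?W \<beta> \<partial>lborel) =
      ennreal (real n * (pos_square (2 * pi / real n - \<theta>' - \<Delta>) + pos_square (\<theta>' - \<Delta>)))"
    unfolding \<theta>'_def by (rule nn_integral_free_length[OF n \<Delta>])
  finally show ?thesis using c by (simp add: ennreal_mult')
qed

text \<open>
  A segment that avoids the folded holes is shorter than the period \<open>2 \<pi> / n\<close>, so cutting the window at
  \<open>\<bar>v\<bar> \<le> 10\<close> loses nothing in the limit.
\<close>

lemma free_drift_bounded:
  assumes n: "n \<ge> 2" and \<Delta>: "\<Delta> > 0" and c: "c > 0" "c \<le> 1"
    and x: "(\<beta>, v) \<in> free_drifts n (two_holes \<theta> \<Delta>) c"
  shows "\<bar>v\<bar> \<le> 10"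
proof (rule ccontr)
  assume v: "\<not> \<bar>v\<bar> \<le> 10"
  let ?T = "2 * pi / real n"
  have T: "0 < ?T" "?T \<le> pi" using n by (auto simp: field_simps)
  have len: "\<bar>v / c\<bar> > 10"
  proof -
    have "10 < \<bar>v\<bar> / 1" using v by simp
    also have "\<dots> \<le> \<bar>v\<bar> / c" using c by (intro divide_left_mono) auto
    finally show ?thesis using c by simp
  qed
  define lo where "lo = min \<beta> (\<beta> - v / c)"
  define hi where "hi = max \<beta> (\<beta> - v / c)"
  have seg: "closed_segment \<beta> (\<beta> - v / c) = {lo..hi}"
    by (auto simp: closed_segment_eq_real_ivl lo_def hi_def)
  have hl: "hi > lo + 10" using len by (auto simp: lo_def hi_def)
  define j where "j = \<lceil>lo / ?T\<rceil>"
  have "lo / ?T \<le> of_int j" "of_int j < lo / ?T + 1" unfolding j_def by linarith+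
  hence j: "lo \<le> of_int j * ?T" "of_int j * ?T < lo + ?T" using n by (auto simp: field_simps)
  \<comment> \<open>A point of the first arc that starts at a multiple of the period beyond \<open>lo\<close>; the cap \<open>2\<close> keeps it below \<open>hi\<close>.\<close>
  define z where "z = of_int j * ?T + min \<Delta> 2 / 2"
  have "z \<le> hi" using j T hl pi_less_4 by (auto simp: z_def)
  moreover have "lo \<le> z" using j \<Delta> by (auto simp: z_def)
  moreover have "z \<in> fold_set n (two_holes \<theta> \<Delta>)"
    using n \<Delta> by (subst fold_two_holes) (auto simp: starts_def z_def intro!: exI[of _ j])
  ultimately have "z \<in> closed_segment \<beta> (\<beta> - v / c) \<inter> fold_set n (two_holes \<theta> \<Delta>)"
    unfolding seg by auto
  thus False using x by (auto simp: free_drifts_def)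
qed

text \<open>
  For fixed \<open>\<beta>\<close> only countably many \<open>v\<close> take the end point into \<open>E\<close>.
\<close>

lemma AE_drift_avoids_countable:
  fixes E :: "real set"
  assumes E: "countable E" and c: "c \<noteq> 0"
  shows "AE (\<beta>, v) in lborel \<Otimes>\<^sub>M lborel. \<beta> \<notin> E \<and> \<beta> - v / c \<notin> E"
proof -
  have [measurable]: "E \<in> sets borel" using E by (rule sets.countable[rotated]) auto
  have nE: "AE y in lborel. y \<notin> E"
    using E by (intro AE_not_in countable_imp_null_set_lborel)
  show ?thesis
  proof (rule lborel_pair.AE_pair_measure)
    show "{x \<in> space (lborel \<Otimes>\<^sub>M lborel). case x of (\<beta>, v) \<Rightarrow> \<beta> \<notin> E \<and> \<beta> - v / c \<notin> E} \<in> sets (lborel \<Otimes>\<^sub>M lborel)"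
      by measurable
    show "AE x in lborel. AE y in lborel. case (x, y) of (\<beta>, v) \<Rightarrow> \<beta> \<notin> E \<and> \<beta> - v / c \<notin> E"
      using nE
    proof eventually_elim
      case (elim x)
      have "AE y in lborel. x + (- 1 / c) * y \<notin> E"
        using c nE by (intro AE_borel_affine) auto
      thus ?case using elim by simp
    qed
  qed
qed

text \<open>
  The rescaled densities are dominated by a constant on a fixed rectangle and converge pointwise
  off a null set: a segment that avoids the folded holes but meets their closure does so in an end
  point only, because its interior is open, and almost surely no end point lies in the countable frontier.
\<close>

lemma window_limit:
  fixes \<theta> \<Delta> :: real and m n :: nat
  defines "\<theta>' \<equiv> \<theta> rmod (2 * pi / real n)"
    and "c \<equiv> sin (pi * real m / real n)" and "\<psi>\<^sub>0 \<equiv> pi / 2 - pi * real m / real n"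
  assumes \<Delta>: "\<Delta> > 0" and n: "n \<ge> 2" and m: "m \<in> totatives n"
  shows "((\<lambda>t. t * measure billiard_measure
            (nonescaping (two_holes \<theta> \<Delta>) t \<inter> {x. \<bar>snd x - \<psi>\<^sub>0\<bar> \<le> 10 / t})) \<longlongrightarrow>
         c\<^sup>2 / (4 * pi) * (real n * (pos_square (2 * pi / real n - \<theta>' - \<Delta>) + pos_square (\<theta>' - \<Delta>))))
         at_top"
proof -
  let ?H = "two_holes \<theta> \<Delta>" and ?M = "lborel \<Otimes>\<^sub>M lborel :: (real \<times> real) measure"
  have mn: "0 < m" "m < n" "coprime m n"
    using m n totatives_less[of m n] by (auto simp: in_totatives_iff)
  have frac: "0 < pi * real m / real n" "pi * real m / real n < pi" using mn by (auto simp: field_simps)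
  have c: "c > 0" "c \<le> 1" unfolding c_def using frac by (auto intro: sin_gt_zero)
  have \<psi>\<^sub>0: "\<bar>\<psi>\<^sub>0\<bar> < pi / 2" using frac unfolding \<psi>\<^sub>0_def abs_less_iff by linarith
  have cos: "cos \<psi>\<^sub>0 = c" by (simp add: \<psi>\<^sub>0_def c_def cos_diff)
  define F where "F = free_drifts n ?H c"
  have F: "F \<in> sets ?M" unfolding F_def using c by (intro sets_free_drifts open_two_holes) auto
  define f where "f x = c / (4 * pi) * indicator F x" for x :: "real \<times> real"
  define w where "w x = 1 / (4 * pi) * indicator ({-pi<..pi} \<times> {-10..10}) x" for x :: "real \<times> real"
  have iw: "integrable ?M w"
  proof -
    have "{-pi<..pi} \<times> {-10..10::real} \<in> sets ?M" by (intro pair_measureI) auto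
    moreover have "emeasure ?M ({-pi<..pi} \<times> {-10..10}) < \<infinity>"
      by (subst lborel.emeasure_pair_measure_Times) (auto simp: ennreal_mult_less_top)
    ultimately show ?thesis unfolding w_def
      by (intro integrable_mult_right) auto
  qed
  define K where "K = closure (fold_set n ?H)"
  have K: "closed K" "fold_set n ?H \<subseteq> K" "countable (K - fold_set n ?H)"
    using countable_frontier_fold_two_holes[of n \<theta> \<Delta>] n by (auto simp: K_def closure_subset)
  have lim: "AE x in ?M. ((\<lambda>t. rescaled_density ?H \<psi>\<^sub>0 t x) \<longlongrightarrow> f x) at_top"
  proof -
    have *: "((\<lambda>t. rescaled_density ?H \<psi>\<^sub>0 t (\<beta>, v)) \<longlongrightarrow> f (\<beta>, v)) at_top"
      if ne: "\<beta> \<notin> K - fold_set n ?H" "\<beta> - v / c \<notin> K - fold_set n ?H" for \<beta> v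
    proof (cases "(\<beta>, v) \<in> F")
      case True
      hence free: "closed_segment \<beta> (\<beta> - v / c) \<inter> fold_set n ?H = {}" and \<beta>: "\<beta> \<in> {-pi<..pi}"
        by (auto simp: F_def free_drifts_def)
      have v: "\<bar>v\<bar> \<le> 10" using free_drift_bounded[OF n \<Delta> c] True by (simp add: F_def)
      have "closed_segment \<beta> (\<beta> - v / c) \<inter> K = {}"
      proof (rule ccontr)
        assume "closed_segment \<beta> (\<beta> - v / c) \<inter> K \<noteq> {}"
        then obtain z where z: "z \<in> closed_segment \<beta> (\<beta> - v / c)" "z \<in> K" by auto
        hence "z \<in> K - fold_set n ?H" using free by auto
        hence "z \<noteq> \<beta>" "z \<noteq> \<beta> - v / c" using ne by auto
        hence "z \<in> open_segment \<beta> (\<beta> - v / c)" using z by (simp add: open_segment_def)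
        moreover have "open_segment \<beta> (\<beta> - v / c) \<inter> fold_set n ?H = {}"
          using free segment_open_subset_closed by blast
        hence "open_segment \<beta> (\<beta> - v / c) \<inter> K = {}"
          unfolding K_def
          by (subst open_Int_closure_eq_empty) (auto simp: open_segment_eq_real_ivl)
        ultimately show False using z by auto
      qed
      hence "\<forall>\<^sub>F t in at_top. survives ?H t \<beta> (\<psi>\<^sub>0 + v / t)"
        unfolding \<psi>\<^sub>0_def using K c n by (intro eventually_survives) (auto simp: c_def)
      hence "\<forall>\<^sub>F t in at_top. cos (\<psi>\<^sub>0 + v / t) / (4 * pi) = rescaled_density ?H \<psi>\<^sub>0 t (\<beta>, v)"
        by eventually_elim (use v \<beta> in \<open>simp add: rescaled_density_def\<close>)
      moreover have "((\<lambda>t. cos (\<psi>\<^sub>0 + v / t) / (4 * pi)) \<longlongrightarrow> cos (\<psi>\<^sub>0 + 0) / (4 * pi)) at_top"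
        by (intro tendsto_intros tendsto_divide_0[OF tendsto_const]
            filterlim_at_top_imp_at_infinity filterlim_ident) auto
      ultimately have "((\<lambda>t. rescaled_density ?H \<psi>\<^sub>0 t (\<beta>, v)) \<longlongrightarrow> cos (\<psi>\<^sub>0 + 0) / (4 * pi)) at_top"
        by (rule Lim_transform_eventually[rotated])
      thus ?thesis using True by (simp add: f_def cos)
    next
      case False
      have "\<forall>\<^sub>F t in at_top. rescaled_density ?H \<psi>\<^sub>0 t (\<beta>, v) = 0"
      proof (cases "\<beta> \<in> {-pi<..pi}")
        case True
        then obtain z where z: "z \<in> closed_segment \<beta> (\<beta> - v / c)" "z \<in> fold_set n ?H"
          using False by (auto simp: F_def free_drifts_def)
        then obtain s where s: "0 \<le> s" "s \<le> 1" "z = \<beta> - s * (v / c)"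
          by (auto simp: in_segment algebra_simps)
        have "\<forall>\<^sub>F t in at_top. \<not> survives ?H t \<beta> (\<psi>\<^sub>0 + v / t)"
          unfolding \<psi>\<^sub>0_def
          by (rule eventually_hit[where s = s])
            (use mn c s z in \<open>auto simp: open_two_holes c_def\<close>)
        thus ?thesis by eventually_elim (simp add: rescaled_density_def)
      qed (auto simp: rescaled_density_def)
      moreover have "f (\<beta>, v) = 0" using False by (simp add: f_def)
      ultimately show ?thesis by (simp add: tendsto_eventually)
    qed
    have "AE (\<beta>, v) in ?M. \<beta> \<notin> K - fold_set n ?H \<and> \<beta> - v / c \<notin> K - fold_set n ?H"
      using c by (intro AE_drift_avoids_countable K) auto
    thus ?thesis by eventually_elim (use * in \<open>auto simp del: Diff_iff\<close>)
  qed
  have "((\<lambda>t. \<integral>x. rescaled_density ?H \<psi>\<^sub>0 t x \<partial>?M) \<longlongrightarrow> (\<integral>x. f x \<partial>?M)) at_top"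
  proof (rule integral_dominated_convergence_at_top[OF _ _ iw lim])
    show "f \<in> borel_measurable ?M" unfolding f_def using F by measurable
    show "rescaled_density ?H \<psi>\<^sub>0 t \<in> borel_measurable ?M" for t
      by (intro borel_measurable_rescaled_density open_two_holes)
    have "norm (rescaled_density ?H \<psi>\<^sub>0 t x) \<le> w x" for t x
    proof -
      have "\<bar>cos (\<psi>\<^sub>0 + snd x / t)\<bar> / (4 * pi) \<le> 1 / (4 * pi)"
        by (intro divide_right_mono) auto
      thus ?thesis by (cases x) (auto simp: rescaled_density_def w_def indicator_def abs_mult)
    qed
    thus "\<forall>\<^sub>F t in at_top. AE x in ?M. norm (rescaled_density ?H \<psi>\<^sub>0 t x) \<le> w x" by simp
  qed
  moreover have "(\<integral>x. f x \<partial>?M) = c / (4 * pi) * measure ?M F"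
    unfolding f_def using F by simp
  moreover have "measure ?M F = c * (real n * (pos_square (2 * pi / real n - \<theta>' - \<Delta>) + pos_square (\<theta>' - \<Delta>)))"
  proof -
    have "emeasure ?M F = ennreal (c * (real n * (pos_square (2 * pi / real n - \<theta>' - \<Delta>) + pos_square (\<theta>' - \<Delta>))))"
      unfolding F_def \<theta>'_def using n \<Delta> c by (intro emeasure_free_drifts) auto
    thus ?thesis using c by (intro measure_eq_emeasure_eq_ennreal) (auto simp: pos_square_def)
  qed
  moreover have "\<forall>\<^sub>F t in at_top. (\<integral>x. rescaled_density ?H \<psi>\<^sub>0 t x \<partial>?M) =
    t * measure billiard_measure (nonescaping ?H t \<inter> {x. \<bar>snd x - \<psi>\<^sub>0\<bar> \<le> 10 / t})"
  proof -
    have "((\<lambda>t. \<bar>\<psi>\<^sub>0\<bar> + 10 / t) \<longlongrightarrow> \<bar>\<psi>\<^sub>0\<bar> + 0) at_top"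
      by (intro tendsto_intros tendsto_divide_0[OF tendsto_const]
            filterlim_at_top_imp_at_infinity filterlim_ident)
    hence "\<forall>\<^sub>F t in at_top. \<bar>\<psi>\<^sub>0\<bar> + 10 / t < pi / 2" by (rule order_tendstoD(2)) (use \<psi>\<^sub>0 in simp)
    thus ?thesis using eventually_gt_at_top[of 0]
      by eventually_elim (intro measure_window_eq_integral[symmetric]; simp add: open_two_holes)
  qed
  ultimately show ?thesis
    by (auto dest: Lim_transform_eventually simp: power2_eq_square field_simps)
qed

section \<open>Summing over the periodic angles\<close>

lemma fraction_determined:
  assumes "m \<in> totatives n" "m' \<in> totatives n'" "real m / real n = real m' / real n'"
  shows "m = m' \<and> n = n'"
proof -
  have pos: "n > 0" "n' > 0" "coprime m n" "coprime m' n'"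
    using assms by (auto simp: in_totatives_iff)
  have "real (m * n') = real (m' * n)" using assms(3) pos by (simp add: field_simps)
  hence eq: "m * n' = m' * n" by (simp only: of_nat_eq_iff)
  have "n dvd n'" using eq pos by (metis coprime_commute coprime_dvd_mult_right_iff dvd_triv_right)
  moreover have "n' dvd n" using eq pos by (metis coprime_commute coprime_dvd_mult_right_iff dvd_triv_right)
  ultimately have "n = n'" by (rule dvd_antisym)
  thus ?thesis using eq pos by simp
qed

lemma sets_billiard_measure_nonescaping_window:
  assumes H: "open H" and per: "\<And>x (j::int). x + of_int j * (2 * pi) \<in> H \<longleftrightarrow> x \<in> H"
  shows "nonescaping H t \<inter> {x. \<bar>snd x - a\<bar> \<le> b} \<in> sets billiard_measure"
    and "nonescaping H t \<in> sets billiard_measure"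
proof -
  have "nonescaping H t = phase_space \<inter> {x. survives H t (fst x) (snd x)}"
  proof (intro set_eqI)
    fix x :: "real \<times> real"
    obtain \<beta> \<psi> where x: "x = (\<beta>, \<psi>)" by fastforce
    show "x \<in> nonescaping H t \<longleftrightarrow> x \<in> phase_space \<inter> {x. survives H t (fst x) (snd x)}"
      using nonescaping_iff_survives[OF per, of \<beta> \<psi> t] by (auto simp: x nonescaping_def)
  qed
  hence N: "nonescaping H t \<in> sets borel" using sets_survives[OF H, of t] by auto
  moreover have "closed {x::real\<times>real. \<bar>snd x - a\<bar> \<le> b}"
    by (intro closed_Collect_le continuous_intros)
  ultimately have "nonescaping H t \<inter> {x. \<bar>snd x - a\<bar> \<le> b} \<in> sets borel" by auto
  with N show "nonescaping H t \<inter> {x. \<bar>snd x - a\<bar> \<le> b} \<in> sets billiard_measure" "nonescaping H t \<in> sets billiard_measure"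
    by (auto simp: billiard_measure_def sets_restrict_space_iff nonescaping_def)
qed

lemma finite_billiard_measure: "emeasure billiard_measure A < \<infinity>"
proof -
  have "emeasure billiard_measure A \<le> emeasure billiard_measure (space billiard_measure)"
    by (rule emeasure_space)
  also have "space billiard_measure = phase_space"
    by (simp add: billiard_measure_def space_restrict_space)
  also have "emeasure billiard_measure phase_space =
    (\<integral>\<^sup>+\<beta>. \<integral>\<^sup>+\<psi>. ennreal (cos \<psi> / (4 * pi)) * indicator phase_space (\<beta>, \<psi>) \<partial>lborel \<partial>lborel)"
    by (rule emeasure_billiard) auto
  also have "\<dots> \<le> (\<integral>\<^sup>+\<beta>. \<integral>\<^sup>+\<psi>. indicator {-pi<..pi} \<beta> * indicator {-(pi/2)..pi/2} \<psi> \<partial>lborel \<partial>lborel)"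
  proof (intro nn_integral_mono)
    fix \<beta> \<psi> :: real
    have "cos \<psi> / (4 * pi) \<le> 1 / 1"
      using pi_ge_two by (intro frac_le) auto
    hence "ennreal (cos \<psi> / (4 * pi)) \<le> 1" by (simp add: ennreal_le_1)
    thus "ennreal (cos \<psi> / (4 * pi)) * indicator phase_space (\<beta>, \<psi>) \<le>
        indicator {-pi<..pi} \<beta> * indicator {-(pi/2)..pi/2} \<psi>"
      by (auto simp: phase_space_def indicator_def)
  qed
  also have "\<dots> = ennreal (2 * pi) * ennreal pi"
    by (simp add: nn_integral_cmult nn_integral_multc)
  also have "\<dots> < \<infinity>" by (simp add: ennreal_mult_less_top)
  finally show ?thesis .
qed

theorem theorem2:
  fixes \<theta> \<Delta> :: real
  assumes "0 < \<Delta>" and "\<Delta> < pi / 2"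
    and "0 \<le> \<theta>" and "\<theta> < 2 * pi"
  shows "((\<lambda>t. t * measure billiard_measure (nonescaping (two_holes \<theta> \<Delta>) t)) \<longlongrightarrow>
           1 / (8 * pi) *
             (\<Sum>n = 1..nat \<lfloor>2 * pi / \<Delta>\<rfloor>.
                real n * (real (totient n) - real_of_int (moebius_mu n)) *
                (let \<theta>' = \<theta> rmod (2 * pi / real n) in
                   pos_square (2 * pi / real n - \<theta>' - \<Delta>) + pos_square (\<theta>' - \<Delta>))))
         at_top"
proof -
  let ?H = "two_holes \<theta> \<Delta>"
  note per = two_holes_shift[of _ _ \<theta> \<Delta>] and op = open_two_holes[of \<theta> \<Delta>]
  define P where "P = nat \<lfloor>2 * pi / \<Delta>\<rfloor>"
  \<comment> \<open>One more than the length of the sum, so that \<open>2 \<pi> / Q < \<Delta>\<close>; for \<open>n = Q\<close> both gaps are empty.\<close>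
  define Q where "Q = P + 1"
  define gaps where "gaps n = pos_square (2 * pi / real n - \<theta> rmod (2 * pi / real n) - \<Delta>) +
      pos_square (\<theta> rmod (2 * pi / real n) - \<Delta>)" for n
  define R where "R = (SIGMA n:{2..Q}. totatives n)"
  define \<Psi> where "\<Psi> = (\<lambda>(n, m). pi / 2 - pi * real m / real n)"
  define Win where "Win t r = nonescaping ?H t \<inter> {x. \<bar>snd x - \<Psi> r\<bar> \<le> 10 / t}" for t r
  have finR: "finite R" by (auto simp: R_def)
  have "2 * pi / \<Delta> < real_of_int (\<lfloor>2 * pi / \<Delta>\<rfloor> + 1)" by linarith
  also have "\<lfloor>2 * pi / \<Delta>\<rfloor> + 1 = int Q" using assms by (simp add: Q_def P_def)
  finally have PQ: "2 * pi / \<Delta> < real Q" by simp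
  hence Q: "2 * pi / real Q \<le> \<Delta>" "Q > 0" using assms by (auto simp: field_simps Q_def)
  have inj: "inj_on \<Psi> R"
  proof (rule inj_onI)
    fix r r' assume r: "r \<in> R" "r' \<in> R" "\<Psi> r = \<Psi> r'"
    obtain n m n' m' where rr: "r = (n, m)" "r' = (n', m')" by fastforce
    have "pi * (real m / real n) = pi * (real m' / real n')" using r(3) by (simp add: rr \<Psi>_def)
    hence "real m / real n = real m' / real n'" by (subst (asm) mult_cancel_left) simp
    thus "r = r'" using fraction_determined[of m n m' n'] r by (auto simp: rr R_def)
  qed
  \<comment> \<open>The angles \<open>\<plusminus> \<pi>/2\<close>, where the density vanishes, form a null set of the billiard measure.\<close>
  have cover: "AE x in billiard_measure. x \<in> nonescaping ?H t \<longleftrightarrow> x \<in> (\<Union>r\<in>R. Win t r)" if t: "t \<ge> 10" for t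
  proof -
    have "x \<in> nonescaping ?H t \<longleftrightarrow> x \<in> (\<Union>r\<in>R. Win t r)"
      if x: "x \<in> phase_space" and pos: "0 < (case x of (\<beta>, \<psi>) \<Rightarrow> ennreal (cos \<psi> / (4 * pi)))" for x
    proof -
      obtain \<beta> \<psi> where x': "x = (\<beta>, \<psi>)" by fastforce
      have "cos \<psi> > 0" using pos by (simp add: x' zero_less_divide_iff)
      hence "\<psi> \<noteq> pi / 2" "\<psi> \<noteq> - (pi / 2)" by (metis cos_minus cos_pi_half less_irrefl)+
      hence \<psi>: "-(pi / 2) < \<psi>" "\<psi> < pi / 2" using x by (auto simp: x' phase_space_def)
      have "x \<in> (\<Union>r\<in>R. Win t r)" if ne: "x \<in> nonescaping ?H t"
      proof -
        have "survives ?H t \<beta> \<psi>" using nonescaping_iff_survives[of ?H, OF per] x ne x' by blast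
        then obtain n m where nm: "n \<in> {2..Q}" "m \<in> totatives n"
            "\<bar>\<psi> - (pi / 2 - pi * real m / real n)\<bar> \<le> 10 / t"
          using survivor_near_periodic[OF Q(2,1) assms(2) \<psi> t, of ?H \<beta>] by (auto simp: two_holes_def)
        hence "(n, m) \<in> R" "x \<in> Win t (n, m)" using ne by (auto simp: R_def Win_def \<Psi>_def x')
        thus ?thesis by blast
      qed
      thus ?thesis by (auto simp: Win_def)
    qed
    hence "AE x in restrict_space lborel phase_space. 0 < (case x of (\<beta>, \<psi>) \<Rightarrow> ennreal (cos \<psi> / (4 * pi))) \<longrightarrow>
        (x \<in> nonescaping ?H t \<longleftrightarrow> x \<in> (\<Union>r\<in>R. Win t r))"
      by (intro AE_I2) (auto simp: space_restrict_space)
    moreover have "(\<lambda>(\<beta>::real, \<psi>). ennreal (cos \<psi> / (4 * pi))) \<in> borel_measurable (restrict_space lborel phase_space)"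
      using measurable_restrict_space1[OF measurable_density_fun] by (simp cong: measurable_cong_sets)
    ultimately show ?thesis unfolding billiard_measure_def by (subst AE_density) auto
  qed
  \<comment> \<open>Finitely many distinct angles are separated by a positive distance, and the windows shrink.\<close>
  have disj: "\<forall>\<^sub>F t in at_top. disjoint_family_on (Win t) R"
  proof -
    have "\<forall>\<^sub>F t in at_top. \<forall>p\<in>R \<times> R. fst p \<noteq> snd p \<longrightarrow> 20 / t < \<bar>\<Psi> (fst p) - \<Psi> (snd p)\<bar>"
    proof (intro eventually_ball_finite ballI)
      fix p assume p: "p \<in> R \<times> R"
      show "\<forall>\<^sub>F t in at_top. fst p \<noteq> snd p \<longrightarrow> 20 / t < \<bar>\<Psi> (fst p) - \<Psi> (snd p)\<bar>"
      proof (cases "fst p = snd p")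
        case False
        hence pos: "\<bar>\<Psi> (fst p) - \<Psi> (snd p)\<bar> > 0" using inj p by (auto dest: inj_onD)
        have "((\<lambda>t. 20 / t) \<longlongrightarrow> (0::real)) at_top"
          by (intro tendsto_divide_0[OF tendsto_const] filterlim_at_top_imp_at_infinity filterlim_ident)
        hence "\<forall>\<^sub>F t in at_top. 20 / t < \<bar>\<Psi> (fst p) - \<Psi> (snd p)\<bar>" 
          using pos by (rule order_tendstoD(2))
        thus ?thesis by eventually_elim simp
      qed simp
    qed (use finR in auto)
    thus ?thesis
    proof eventually_elim
      case (elim t)
      show ?case unfolding disjoint_family_on_def
      proof (intro ballI impI equals0I)
        fix r r' x assume r: "r \<in> R" "r' \<in> R" "r \<noteq> r'" and x: "x \<in> Win t r \<inter> Win t r'"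
        hence "20 / t < \<bar>\<Psi> r - \<Psi> r'\<bar>" using elim by force
        moreover have "\<bar>snd x - \<Psi> r\<bar> \<le> 10 / t" "\<bar>snd x - \<Psi> r'\<bar> \<le> 10 / t" using x by (auto simp: Win_def)
        ultimately show False by linarith
      qed
    qed
  qed
  have sets: "Win t r \<in> sets billiard_measure" "nonescaping ?H t \<in> sets billiard_measure" for t r
    unfolding Win_def using sets_billiard_measure_nonescaping_window[OF op per] by auto
  have split: "\<forall>\<^sub>F t in at_top. (\<Sum>r\<in>R. t * measure billiard_measure (Win t r)) =
      t * measure billiard_measure (nonescaping ?H t)"
    using disj eventually_ge_at_top[of 10]
  proof eventually_elim
    case (elim t)
    have "measure billiard_measure (nonescaping ?H t) = measure billiard_measure (\<Union>r\<in>R. Win t r)"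
      using cover[OF elim(2)] sets finR by (intro measure_eq_AE) auto
    also have "\<dots> = (\<Sum>r\<in>R. measure billiard_measure (Win t r))"
      using elim(1) sets finR finite_billiard_measure
      by (intro measure_finite_Union) (auto simp: less_top)
    finally show ?case by (simp add: sum_distrib_left)
  qed
  have "((\<lambda>t. \<Sum>r\<in>R. t * measure billiard_measure (Win t r)) \<longlongrightarrow>
      (\<Sum>r\<in>R. case r of (n, m) \<Rightarrow> (sin (pi * real m / real n))\<^sup>2 / (4 * pi) * (real n * gaps n))) at_top"
  proof (intro tendsto_sum)
    fix r assume "r \<in> R"
    then obtain n m where r: "r = (n, m)" "n \<ge> 2" "m \<in> totatives n" by (auto simp: R_def)
    show "((\<lambda>t. t * measure billiard_measure (Win t r)) \<longlongrightarrow>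
      (case r of (n, m) \<Rightarrow> (sin (pi * real m / real n))\<^sup>2 / (4 * pi) * (real n * gaps n))) at_top"
      using window_limit[OF assms(1) r(2,3), of \<theta>] by (simp add: Win_def \<Psi>_def r(1) gaps_def)
  qed
  hence lim: "((\<lambda>t. t * measure billiard_measure (nonescaping ?H t)) \<longlongrightarrow>
      (\<Sum>r\<in>R. case r of (n, m) \<Rightarrow> (sin (pi * real m / real n))\<^sup>2 / (4 * pi) * (real n * gaps n))) at_top"
    using split by (rule Lim_transform_eventually)
  have "(\<Sum>r\<in>R. case r of (n, m) \<Rightarrow> (sin (pi * real m / real n))\<^sup>2 / (4 * pi) * (real n * gaps n)) =
    (\<Sum>n = 2..Q. \<Sum>m\<in>totatives n. (sin (pi * real m / real n))\<^sup>2 / (4 * pi) * (real n * gaps n))"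
    unfolding R_def by (rule sum.Sigma[symmetric]) auto
  also have "\<dots> = (\<Sum>n = 2..Q. 1 / (8 * pi) * (real n * (real (totient n) - real_of_int (moebius_mu n)) * gaps n))"
  proof (rule sum.cong[OF refl])
    fix n assume "n \<in> {2..Q}"
    hence squares: "(\<Sum>m\<in>totatives n. (sin (pi * real m / real n))\<^sup>2) = (real (totient n) - real_of_int (moebius_mu n)) / 2"
      by (intro sum_sin_squared_totatives) auto
    have "(\<Sum>m\<in>totatives n. (sin (pi * real m / real n))\<^sup>2 / (4 * pi) * (real n * gaps n)) =
        (\<Sum>m\<in>totatives n. (sin (pi * real m / real n))\<^sup>2) / (4 * pi) * (real n * gaps n)"
      by (simp only: sum_divide_distrib sum_distrib_right)
    thus "(\<Sum>m\<in>totatives n. (sin (pi * real m / real n))\<^sup>2 / (4 * pi) * (real n * gaps n)) =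
        1 / (8 * pi) * (real n * (real (totient n) - real_of_int (moebius_mu n)) * gaps n)"
      by (simp add: squares)
  qed
  also have "\<dots> = (\<Sum>n = 1..Q. 1 / (8 * pi) * (real n * (real (totient n) - real_of_int (moebius_mu n)) * gaps n))"
  proof (rule sum.mono_neutral_left)
    show "\<forall>n\<in>{1..Q} - {2..Q}. 1 / (8 * pi) * (real n * (real (totient n) - real_of_int (moebius_mu n)) * gaps n) = 0"
    proof
      fix n assume "n \<in> {1..Q} - {2..Q}"
      hence "n = 1" by auto
      thus "1 / (8 * pi) * (real n * (real (totient n) - real_of_int (moebius_mu n)) * gaps n) = 0"
        by (simp add: moebius_mu_def)
    qed
  qed auto
  also have "\<dots> = (\<Sum>n = 1..P. 1 / (8 * pi) * (real n * (real (totient n) - real_of_int (moebius_mu n)) * gaps n))"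
  proof -
    have "\<theta> rmod (2 * pi / real Q) \<ge> 0" "\<theta> rmod (2 * pi / real Q) < 2 * pi / real Q"
      using Q(2) by (auto intro!: rmod_nonneg rmod_less)
    hence "gaps Q = 0" using Q(1) by (simp add: gaps_def pos_square_def)
    thus ?thesis by (simp add: Q_def)
  qed
  finally show ?thesis using lim
    by (simp add: gaps_def P_def Let_def sum_distrib_left)
qed

end
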